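(* Suppose $T$ is a complete theory in a countable language with uncountably many complete 1-types. Then every model $M$ of $T$ has a Borel complete reduct.
   Context: Given an $L$-structure $M$, a reduct of $M$ is an $L'$-structure $M'$ (with $L'$ countable) with the same universe as $M$ such that the interpretation in $M'$ of every atomic $L'$-formula $\alpha(x_1,\dots,x_k)$ is an $L$-definable (without parameters) subset of $M^k$. "$M$ has a Borel complete reduct" means some reduct $M'$ of $M$ has Borel complete theory $Th(M')$. For a countable theory $T$, ${\rm Mod}(T)$ is the space of models of $T$ with universe $\omega$; $T$ is Borel reducible to $S$ if there is a Borel $f:{\rm Mod}(T)\to{\rm Mod}(S)$ with $M\cong N\iff f(M)\cong f(N)$; $T$ is Borel complete if it is maximal under Borel reducibility among Borel classes of countable structures invariant under permutations of $\omega$ (equivalently, countable graphs are Borel reducible to it). *)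

theory Defs
  imports "HOL-Analysis.Analysis"
begin

section \<open>Languages, formulas and structures\<close>

text \<open>Symbols are carved out of the types by explicit sets, so that languages without function
  symbols or without relation symbols are covered.  Constants are function symbols of arity 0.\<close>

record ('f, 'r) fo_language =
  funs :: "'f set"
  fun_arity :: "'f \<Rightarrow> nat"
  rels :: "'r set"
  rel_arity :: "'r \<Rightarrow> nat"

definition countable_language :: "('f, 'r) fo_language \<Rightarrow> bool" where
  "countable_language L \<longleftrightarrow> countable (funs L) \<and> countable (rels L)"

datatype 'f tm = Var nat | App 'f "'f tm list"

datatype ('f, 'r) fm =
    Eq "'f tm" "'f tm"
  | Rel 'r "'f tm list"
  | Neg "('f, 'r) fm"
  | And "('f, 'r) fm" "('f, 'r) fm"
  | Ex nat "('f, 'r) fm"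

fun tm_of :: "('f, 'r) fo_language \<Rightarrow> 'f tm \<Rightarrow> bool" where
  "tm_of L (Var x) \<longleftrightarrow> True"
| "tm_of L (App f ts) \<longleftrightarrow> f \<in> funs L \<and> length ts = fun_arity L f \<and> (\<forall>t\<in>set ts. tm_of L t)"

fun fm_of :: "('f, 'r) fo_language \<Rightarrow> ('f, 'r) fm \<Rightarrow> bool" where
  "fm_of L (Eq s t) \<longleftrightarrow> tm_of L s \<and> tm_of L t"
| "fm_of L (Rel R ts) \<longleftrightarrow> R \<in> rels L \<and> length ts = rel_arity L R \<and> (\<forall>t\<in>set ts. tm_of L t)"
| "fm_of L (Neg \<phi>) \<longleftrightarrow> fm_of L \<phi>"
| "fm_of L (And \<phi> \<psi>) \<longleftrightarrow> fm_of L \<phi> \<and> fm_of L \<psi>"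
| "fm_of L (Ex x \<phi>) \<longleftrightarrow> fm_of L \<phi>"

fun tm_vars :: "'f tm \<Rightarrow> nat set" where
  "tm_vars (Var x) = {x}"
| "tm_vars (App f ts) = (\<Union>t\<in>set ts. tm_vars t)"

fun free_vars :: "('f, 'r) fm \<Rightarrow> nat set" where
  "free_vars (Eq s t) = tm_vars s \<union> tm_vars t"
| "free_vars (Rel R ts) = (\<Union>t\<in>set ts. tm_vars t)"
| "free_vars (Neg \<phi>) = free_vars \<phi>"
| "free_vars (And \<phi> \<psi>) = free_vars \<phi> \<union> free_vars \<psi>"
| "free_vars (Ex x \<phi>) = free_vars \<phi> - {x}"

fun atomic :: "('f, 'r) fm \<Rightarrow> bool" where
  "atomic (Eq s t) \<longleftrightarrow> True"
| "atomic (Rel R ts) \<longleftrightarrow> True"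
| "atomic _ \<longleftrightarrow> False"

definition sentence :: "('f, 'r) fo_language \<Rightarrow> ('f, 'r) fm \<Rightarrow> bool" where
  "sentence L \<sigma> \<longleftrightarrow> fm_of L \<sigma> \<and> free_vars \<sigma> = {}"

record ('f, 'r, 'a) fo_structure =
  univ :: "'a set"
  fun_int :: "'f \<Rightarrow> 'a list \<Rightarrow> 'a"
  rel_int :: "'r \<Rightarrow> 'a list set"

definition tuples :: "'a set \<Rightarrow> nat \<Rightarrow> 'a list set" where
  "tuples A k = {xs. length xs = k \<and> set xs \<subseteq> A}"

text \<open>The values of \<open>fun_int\<close> and \<open>rel_int\<close> at symbols outside \<open>L\<close> and at tuples of the wrong
  length or outside the universe are unconstrained, and are irrelevant to the semantics.\<close>

definition structure_of :: "('f, 'r) fo_language \<Rightarrow> ('f, 'r, 'a) fo_structure \<Rightarrow> bool" where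
  "structure_of L M \<longleftrightarrow> univ M \<noteq> {} \<and>
     (\<forall>f\<in>funs L. \<forall>xs\<in>tuples (univ M) (fun_arity L f). fun_int M f xs \<in> univ M)"

fun tm_val :: "('f, 'r, 'a) fo_structure \<Rightarrow> (nat \<Rightarrow> 'a) \<Rightarrow> 'f tm \<Rightarrow> 'a" where
  "tm_val M e (Var x) = e x"
| "tm_val M e (App f ts) = fun_int M f (map (tm_val M e) ts)"

fun sat :: "('f, 'r, 'a) fo_structure \<Rightarrow> (nat \<Rightarrow> 'a) \<Rightarrow> ('f, 'r) fm \<Rightarrow> bool" where
  "sat M e (Eq s t) \<longleftrightarrow> tm_val M e s = tm_val M e t"
| "sat M e (Rel R ts) \<longleftrightarrow> map (tm_val M e) ts \<in> rel_int M R"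
| "sat M e (Neg \<phi>) \<longleftrightarrow> \<not> sat M e \<phi>"
| "sat M e (And \<phi> \<psi>) \<longleftrightarrow> sat M e \<phi> \<and> sat M e \<psi>"
| "sat M e (Ex x \<phi>) \<longleftrightarrow> (\<exists>a\<in>univ M. sat M (e(x := a)) \<phi>)"

definition satisfies :: "('f, 'r, 'a) fo_structure \<Rightarrow> ('f, 'r) fm \<Rightarrow> bool" where
  "satisfies M \<sigma> \<longleftrightarrow> (\<forall>e. range e \<subseteq> univ M \<longrightarrow> sat M e \<sigma>)"

definition model_of ::
    "('f, 'r) fo_language \<Rightarrow> ('f, 'r) fm set \<Rightarrow> ('f, 'r, 'a) fo_structure \<Rightarrow> bool" where
  "model_of L T M \<longleftrightarrow> structure_of L M \<and> (\<forall>\<sigma>\<in>T. satisfies M \<sigma>)"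

definition Th :: "('f, 'r) fo_language \<Rightarrow> ('f, 'r, 'a) fo_structure \<Rightarrow> ('f, 'r) fm set" where
  "Th L M = {\<sigma>. sentence L \<sigma> \<and> satisfies M \<sigma>}"


section \<open>Complete theories and complete 1-types\<close>

text \<open>HOL cannot quantify over models of all types inside a definition.  Entailment and
  satisfiability therefore range over the models whose universe is an arbitrary nonempty (finite
  or infinite) subset of \<open>nat\<close>; for countable languages, the only ones considered, this agrees with
  the unrestricted notions by the downward Loewenheim-Skolem theorem.\<close>

definition entails ::
    "('f, 'r) fo_language \<Rightarrow> ('f, 'r) fm set \<Rightarrow> ('f, 'r) fm \<Rightarrow> bool" where
  "entails L T \<sigma> \<longleftrightarrow> (\<forall>N :: ('f, 'r, nat) fo_structure. model_of L T N \<longrightarrow> satisfies N \<sigma>)"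

definition complete_theory :: "('f, 'r) fo_language \<Rightarrow> ('f, 'r) fm set \<Rightarrow> bool" where
  "complete_theory L T \<longleftrightarrow>
     (\<forall>\<sigma>\<in>T. sentence L \<sigma>) \<and>
     (\<exists>N :: ('f, 'r, nat) fo_structure. model_of L T N) \<and>
     (\<forall>\<sigma>. sentence L \<sigma> \<longrightarrow> entails L T \<sigma> \<or> entails L T (Neg \<sigma>))"

definition one_formulas :: "('f, 'r) fo_language \<Rightarrow> ('f, 'r) fm set" where
  "one_formulas L = {\<phi>. fm_of L \<phi> \<and> free_vars \<phi> \<subseteq> {0}}"

text \<open>\<open>p\<close> is consistent with \<open>T\<close> and decides every formula in the variable 0.  As no other
  variable is free in \<open>p\<close>, the constant assignment \<open>\<lambda>_. a\<close> just assigns \<open>a\<close> to that variable.\<close>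

definition complete_1_types ::
    "('f, 'r) fo_language \<Rightarrow> ('f, 'r) fm set \<Rightarrow> ('f, 'r) fm set set" where
  "complete_1_types L T = {p. p \<subseteq> one_formulas L \<and>
     (\<exists>N :: ('f, 'r, nat) fo_structure. model_of L T N \<and>
        (\<exists>a\<in>univ N. \<forall>\<phi>\<in>p. sat N (\<lambda>_. a) \<phi>)) \<and>
     (\<forall>\<phi>\<in>one_formulas L. \<phi> \<in> p \<or> Neg \<phi> \<in> p)}"


section \<open>Reducts\<close>

text \<open>The subset of \<open>M\<^sup>k\<close> given by a formula in the variables \<open>0, \<dots>, k - 1\<close>.\<close>

definition solution_set ::
    "('f, 'r, 'a) fo_structure \<Rightarrow> nat \<Rightarrow> ('f, 'r) fm \<Rightarrow> 'a list set" where
  "solution_set M k \<phi> = {xs \<in> tuples (univ M) k. sat M (\<lambda>i. xs ! i) \<phi>}"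

definition definable ::
    "('f, 'r) fo_language \<Rightarrow> ('f, 'r, 'a) fo_structure \<Rightarrow> nat \<Rightarrow> 'a list set \<Rightarrow> bool" where
  "definable L M k D \<longleftrightarrow>
     (\<exists>\<phi>. fm_of L \<phi> \<and> free_vars \<phi> \<subseteq> {..<k} \<and> D = solution_set M k \<phi>)"

definition reduct ::
    "('f, 'r) fo_language \<Rightarrow> ('f, 'r, 'a) fo_structure \<Rightarrow>
     ('g, 's) fo_language \<Rightarrow> ('g, 's, 'a) fo_structure \<Rightarrow> bool" where
  "reduct L M L' M' \<longleftrightarrow>
     countable_language L' \<and> structure_of L' M' \<and> univ M' = univ M \<and>
     (\<forall>\<alpha> k. atomic \<alpha> \<and> fm_of L' \<alpha> \<and> free_vars \<alpha> \<subseteq> {..<k} \<longrightarrow>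
        definable L M k (solution_set M' k \<alpha>))"


section \<open>The space of structures with universe \<open>\<omega>\<close> and Borel reducibility\<close>

text \<open>Here the irrelevant values of the interpretations are pinned down, so that the elements
  correspond bijectively to \<open>L\<close>-structures with universe \<open>\<omega>\<close>.\<close>

definition omega_structures :: "('f, 'r) fo_language \<Rightarrow> ('f, 'r, nat) fo_structure set" where
  "omega_structures L = {N. univ N = UNIV \<and>
     (\<forall>f xs. \<not> (f \<in> funs L \<and> length xs = fun_arity L f) \<longrightarrow> fun_int N f xs = undefined) \<and>
     (\<forall>R. \<forall>xs\<in>rel_int N R. R \<in> rels L \<and> length xs = rel_arity L R)}"

text \<open>The product topology on
  \<open>(\<Prod>f. \<omega> ^ (\<omega> ^ arity f)) \<times> (\<Prod>R. 2 ^ (\<omega> ^ arity R))\<close>, with \<open>\<omega>\<close> and \<open>2\<close> discrete, given by its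
  standard subbasis.  The whole space is added to the subbasis for the sake of the empty language.\<close>

definition omega_topology :: "('f, 'r) fo_language \<Rightarrow> ('f, 'r, nat) fo_structure topology" where
  "omega_topology L = topology_generated_by (
     {omega_structures L} \<union>
     {{N \<in> omega_structures L. fun_int N f xs = y} | f xs y. f \<in> funs L \<and> length xs = fun_arity L f} \<union>
     {{N \<in> omega_structures L. xs \<in> rel_int N R} | R xs. R \<in> rels L \<and> length xs = rel_arity L R} \<union>
     {{N \<in> omega_structures L. xs \<notin> rel_int N R} | R xs. R \<in> rels L \<and> length xs = rel_arity L R})"

lemma topspace_omega_topology: "topspace (omega_topology L) = omega_structures L"
  unfolding omega_topology_def topology_generated_by_topspace by blast

definition omega_borel :: "('f, 'r) fo_language \<Rightarrow> ('f, 'r, nat) fo_structure measure" where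
  "omega_borel L = sigma (omega_structures L) {U. openin (omega_topology L) U}"

lemma space_omega_borel: "space (omega_borel L) = omega_structures L"
  and sets_omega_borel:
    "sets (omega_borel L) = sigma_sets (omega_structures L) {U. openin (omega_topology L) U}"
proof -
  have "{U. openin (omega_topology L) U} \<subseteq> Pow (omega_structures L)"
    using openin_subset topspace_omega_topology by blast
  then show "space (omega_borel L) = omega_structures L"
    and "sets (omega_borel L) = sigma_sets (omega_structures L) {U. openin (omega_topology L) U}"
    by (simp_all add: omega_borel_def)
qed

definition isomorphic ::
    "('f, 'r) fo_language \<Rightarrow> ('f, 'r, 'a) fo_structure \<Rightarrow> ('f, 'r, 'b) fo_structure \<Rightarrow> bool" where
  "isomorphic L M N \<longleftrightarrow> (\<exists>h. bij_betw h (univ M) (univ N) \<and>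
     (\<forall>f\<in>funs L. \<forall>xs\<in>tuples (univ M) (fun_arity L f).
        h (fun_int M f xs) = fun_int N f (map h xs)) \<and>
     (\<forall>R\<in>rels L. \<forall>xs\<in>tuples (univ M) (rel_arity L R).
        xs \<in> rel_int M R \<longleftrightarrow> map h xs \<in> rel_int N R))"

definition Mod :: "('f, 'r) fo_language \<Rightarrow> ('f, 'r) fm set \<Rightarrow> ('f, 'r, nat) fo_structure set" where
  "Mod L T = {N \<in> omega_structures L. model_of L T N}"

text \<open>Two structures with universe \<open>\<omega>\<close> are isomorphic iff a permutation of \<open>\<omega>\<close> carries one to the
  other, so invariance under permutations is closure under isomorphism.\<close>

definition invariant_borel_class ::
    "('f, 'r) fo_language \<Rightarrow> ('f, 'r, nat) fo_structure set \<Rightarrow> bool" where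
  "invariant_borel_class L K \<longleftrightarrow> K \<in> sets (omega_borel L) \<and>
     (\<forall>M\<in>K. \<forall>N\<in>omega_structures L. isomorphic L M N \<longrightarrow> N \<in> K)"

definition borel_reducible ::
    "('f, 'r) fo_language \<Rightarrow> ('f, 'r, nat) fo_structure set \<Rightarrow>
     ('g, 's) fo_language \<Rightarrow> ('g, 's, nat) fo_structure set \<Rightarrow> bool" where
  "borel_reducible L K L' K' \<longleftrightarrow>
     (\<exists>F \<in> restrict_space (omega_borel L) K \<rightarrow>\<^sub>M restrict_space (omega_borel L') K'.
        \<forall>M\<in>K. \<forall>N\<in>K. isomorphic L M N \<longleftrightarrow> isomorphic L' (F M) (F N))"

text \<open>Maximality is meant in the sense of a greatest element: every invariant Borel class reduces
  to \<open>Mod L T\<close> (which is itself such a class when \<open>L\<close> is countable).  Up to renaming of symbols,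
  every countable language has natural numbers as symbols.\<close>

definition borel_complete :: "('f, 'r) fo_language \<Rightarrow> ('f, 'r) fm set \<Rightarrow> bool" where
  "borel_complete L T \<longleftrightarrow>
     (\<forall>(L\<^sub>0 :: (nat, nat) fo_language) K.
        countable_language L\<^sub>0 \<and> invariant_borel_class L\<^sub>0 K \<longrightarrow>
        borel_reducible L\<^sub>0 K L (Mod L T))"

definition has_borel_complete_reduct ::
    "('f, 'r) fo_language \<Rightarrow> ('f, 'r, 'a) fo_structure \<Rightarrow> bool" where
  "has_borel_complete_reduct L M \<longleftrightarrow>
     (\<exists>(L' :: (nat, nat) fo_language) M'. reduct L M L' M' \<and> borel_complete L' (Th L' M'))"

end

theory Submission
  imports Defs
begin

text \<open>Uncountably many 1-types yield a binary tree of consistent formulas in one variable, hence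
  coordinates \<open>d x k \<in> {0, \<dots>, k + 1}\<close> on \<open>M\<close> whose finite initial segments take all values.
  The reduct has the binary relations \<open>d x k = d y k \<noteq> 0\<close>.  By back and forth its theory is that of
  every set with such rich coordinates, and its models are essentially dense sets of points up to
  the product of the symmetric groups of \<open>{1, \<dots>, k + 1}\<close>.  As \<open>k\<close> tends to infinity, these act like
  an arbitrary permutation of \<open>\<omega>\<close> modulo finite changes of the points.  So the closure under
  finite changes of a set of sequences that code elements of \<open>\<omega>\<close> and tuples in the relations
  of a structure determines this structure up to isomorphism.  Tuples outside the relations are
  coded too; this makes the universe of the code independent of the structure, and the coding
  continuous.\<close>

section \<open>Countability and the downward Loewenheim-Skolem theorem\<close>

text \<open>The number of values of a coordinate meets two conflicting demands. It must be finite,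
  because \<open>d x k = d y k \<noteq> 0\<close> becomes definable in \<open>M\<close> as a finite
  disjunction over the common value; and it must grow with \<open>k\<close>, because each natural
  number has to be a legal value of almost all coordinates. Richness makes every finite pattern of
  values occur, so nothing that is visible on finitely many coordinates carries information. The
  code therefore stores each piece of data on infinitely many coordinates, and it is read modulo
  finite sets of coordinates. Only the value 0 can be read off a single point: a point has it iff it
  is not related to itself, so every isomorphism preserves zeros, and they serve as labels. Nonzero
  values can only be compared with those of other points. This is why elements are coded by points
  too: an entry of a tuple is identified by its agreement with the constant sequence of an
  element.\<close>

instance tm :: (countable) countable
  by countable_datatype

instance fm :: (countable, countable) countable
  by countable_datatype

text \<open>The symbol types need not be countable. Renaming symbols along
  \<open>to_nat_on S\<close> leads into the countable type of terms over \<open>nat\<close>,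
  injectively as long as only symbols from \<open>S\<close> occur.\<close>

lemma countable_tm_over:
  assumes "countable S"
  shows "countable {t :: 'f tm. set_tm t \<subseteq> S}"
proof (rule countable_image_inj_on)
  show "countable (map_tm (to_nat_on S) ` {t :: 'f tm. set_tm t \<subseteq> S})"
    by simp
  show "inj_on (map_tm (to_nat_on S)) {t :: 'f tm. set_tm t \<subseteq> S}"
  proof (rule inj_onI)
    fix s t :: "'f tm"
    assume st: "s \<in> {t. set_tm t \<subseteq> S}" "t \<in> {t. set_tm t \<subseteq> S}"
      "map_tm (to_nat_on S) s = map_tm (to_nat_on S) t"
    show "s = t"
    proof (rule tm.inj_map_strong[OF _ st(3)])
      fix y z assume "y \<in> set_tm s" "z \<in> set_tm t" "to_nat_on S y = to_nat_on S z"
      then show "y = z"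
        using st assms by (metis (mono_tags) mem_Collect_eq subsetD to_nat_on_inj)
    qed
  qed
qed

lemma countable_fm_over:
  assumes "countable S" "countable R"
  shows "countable {\<phi> :: ('f, 'r) fm. set1_fm \<phi> \<subseteq> S \<and> set2_fm \<phi> \<subseteq> R}"
proof (rule countable_image_inj_on)
  let ?A = "{\<phi> :: ('f, 'r) fm. set1_fm \<phi> \<subseteq> S \<and> set2_fm \<phi> \<subseteq> R}"
  let ?m = "map_fm (to_nat_on S) (to_nat_on R)"
  show "countable (?m ` ?A)"
    by simp
  show "inj_on ?m ?A"
  proof (rule inj_onI)
    fix s t :: "('f, 'r) fm"
    assume st: "s \<in> ?A" "t \<in> ?A" "?m s = ?m t"
    show "s = t"
    proof (rule fm.inj_map_strong[OF _ _ st(3)])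
      fix y z assume "y \<in> set1_fm s" "z \<in> set1_fm t" "to_nat_on S y = to_nat_on S z"
      then show "y = z"
        using st assms by (metis (mono_tags, lifting) mem_Collect_eq subsetD to_nat_on_inj)
    next
      fix y z assume "y \<in> set2_fm s" "z \<in> set2_fm t" "to_nat_on R y = to_nat_on R z"
      then show "y = z"
        using st assms by (metis (mono_tags, lifting) mem_Collect_eq subsetD to_nat_on_inj)
    qed
  qed
qed

lemma tm_of_set: "tm_of L t \<Longrightarrow> set_tm t \<subseteq> funs L"
  by (induction t) auto

lemma fm_of_set: "fm_of L \<phi> \<Longrightarrow> set1_fm \<phi> \<subseteq> funs L \<and> set2_fm \<phi> \<subseteq> rels L"
  by (induction \<phi>) (use tm_of_set in fastforce)+

lemma countable_fm_of:
  assumes "countable_language L"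
  shows "countable {\<phi>. fm_of L \<phi>}"
proof (rule countable_subset)
  show "{\<phi>. fm_of L \<phi>} \<subseteq> {\<phi>. set1_fm \<phi> \<subseteq> funs L \<and> set2_fm \<phi> \<subseteq> rels L}"
    using fm_of_set by blast
qed (use assms countable_fm_over in \<open>auto simp: countable_language_def\<close>)

section \<open>Dependence of truth on the free variables\<close>

lemma finite_tm_vars: "finite (tm_vars t)"
  by (induction t) auto

lemma finite_free_vars: "finite (free_vars \<phi>)"
  by (induction \<phi>) (auto simp: finite_tm_vars)

lemma tm_val_cong: "(\<And>x. x \<in> tm_vars t \<Longrightarrow> e x = e' x) \<Longrightarrow> tm_val M e t = tm_val M e' t"
proof (induction t)
  case (App f ts)
  then have "map (tm_val M e) ts = map (tm_val M e') ts"
    by auto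
  then show ?case
    by (metis tm_val.simps(2))
qed simp

lemma sat_cong: "(\<And>x. x \<in> free_vars \<phi> \<Longrightarrow> e x = e' x) \<Longrightarrow> sat M e \<phi> \<longleftrightarrow> sat M e' \<phi>"
proof (induction \<phi> arbitrary: e e')
  case (Eq s t)
  then show ?case
    using tm_val_cong[of s e e' M] tm_val_cong[of t e e' M] by simp
next
  case (Rel R ts)
  then have "map (tm_val M e) ts = map (tm_val M e') ts"
    by (auto intro!: tm_val_cong)
  then show ?case
    by (metis sat.simps(2))
next
  case (And \<phi> \<psi>)
  then show ?case
    by (metis Un_iff free_vars.simps(4) sat.simps(4))
next
  case (Neg \<phi>)
  then show ?case
    by (metis free_vars.simps(3) sat.simps(3))
next
  case (Ex x \<phi>)
  have "sat M (e(x := a)) \<phi> \<longleftrightarrow> sat M (e'(x := a)) \<phi>" for a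
    using Ex.prems by (intro Ex.IH) auto
  then show ?case
    by simp
qed

lemma satisfies_iff_sat:
  assumes "free_vars \<sigma> = {}" "univ M \<noteq> {}"
  shows "satisfies M \<sigma> \<longleftrightarrow> sat M e \<sigma>"
proof -
  obtain a where "a \<in> univ M"
    using assms by blast
  then have "range (\<lambda>_ :: nat. a) \<subseteq> univ M"
    by auto
  moreover have "sat M e' \<sigma> \<longleftrightarrow> sat M e \<sigma>" for e'
    by (rule sat_cong) (simp add: assms(1))
  ultimately show ?thesis
    unfolding satisfies_def by metis
qed

text \<open>Terms over the function symbols and a Skolem symbol for each pair \<open>(\<phi>, x)\<close>; default values
  keep all of them inside the universe, so that arities can be ignored.\<close>

fun skolem_val ::
    "('f, 'r, 'a) fo_structure \<Rightarrow> 'a \<Rightarrow> ('f + ('f, 'r) fm \<times> nat) tm \<Rightarrow> 'a" where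
  "skolem_val M a (Var _) = a"
| "skolem_val M a (App (Inl f) ts) =
     (let v = fun_int M f (map (skolem_val M a) ts) in if v \<in> univ M then v else a)"
| "skolem_val M a (App (Inr (\<phi>, x)) ts) =
     (SOME v. v \<in> univ M \<and>
        ((\<exists>b\<in>univ M. sat M ((\<lambda>i. map (skolem_val M a) ts ! i)(x := b)) \<phi>) \<longrightarrow>
         sat M ((\<lambda>i. map (skolem_val M a) ts ! i)(x := v)) \<phi>))"

lemma skolem_val_witness:
  fixes M :: "('f, 'r, 'a) fo_structure"
  assumes "a \<in> univ M"
  defines "v \<equiv> \<lambda>\<phi> x ts. skolem_val M a (App (Inr (\<phi>, x)) ts)"
    and "e \<equiv> \<lambda>ts i. map (skolem_val M a) ts ! i"
  shows "v \<phi> x ts \<in> univ M"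
    and "\<exists>b\<in>univ M. sat M ((e ts)(x := b)) \<phi> \<Longrightarrow> sat M ((e ts)(x := v \<phi> x ts)) \<phi>"
proof -
  have "\<exists>v. v \<in> univ M \<and>
        ((\<exists>b\<in>univ M. sat M ((e ts)(x := b)) \<phi>) \<longrightarrow> sat M ((e ts)(x := v)) \<phi>)"
    using assms(1) by blast
  from someI_ex[OF this]
  show "v \<phi> x ts \<in> univ M"
    and "\<exists>b\<in>univ M. sat M ((e ts)(x := b)) \<phi> \<Longrightarrow> sat M ((e ts)(x := v \<phi> x ts)) \<phi>"
    by (simp_all add: v_def e_def)
qed

lemma skolem_val_in_univ:
  assumes "a \<in> univ M"
  shows "skolem_val M a t \<in> univ M"
proof (cases t)
  case (App s ts)
  then show ?thesis
    using assms skolem_val_witness(1)[OF assms]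
    by (cases s) (auto simp: Let_def simp del: skolem_val.simps(3))
qed (use assms in simp)

text \<open>The last property is the Tarski-Vaught criterion. \<open>A\<close> consists of the
  values of all Skolem terms, hence is closed under the functions and under choosing
  witnesses.\<close>

lemma skolem_hull:
  fixes M :: "('f, 'r, 'a) fo_structure"
  assumes L: "countable_language L" and M: "structure_of L M"
  obtains A where "A \<subseteq> univ M" "A \<noteq> {}" "countable A"
    and "\<And>f xs. f \<in> funs L \<Longrightarrow> xs \<in> tuples A (fun_arity L f) \<Longrightarrow> fun_int M f xs \<in> A"
    and "\<And>\<phi> x e b. fm_of L \<phi> \<Longrightarrow> range e \<subseteq> A \<Longrightarrow> b \<in> univ M \<Longrightarrow> sat M (e(x := b)) \<phi> \<Longrightarrow>
           \<exists>b\<in>A. sat M (e(x := b)) \<phi>"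
proof -
  obtain a where a: "a \<in> univ M"
    using M by (auto simp: structure_of_def)
  define S where "S = Inl ` funs L \<union> Inr ` ({\<phi>. fm_of L \<phi>} \<times> (UNIV :: nat set))"
  define H where "H = {t :: ('f + ('f, 'r) fm \<times> nat) tm. set_tm t \<subseteq> S}"
  define A where "A = skolem_val M a ` H"
  have "countable S"
    using L countable_fm_of[OF L] by (auto simp: S_def countable_language_def)
  then have "countable H"
    unfolding H_def by (rule countable_tm_over)
  have lists: "\<exists>ts. set ts \<subseteq> H \<and> xs = map (skolem_val M a) ts" if "set xs \<subseteq> A" for xs
    using that
  proof (induction xs)
    case (Cons x xs)
    then obtain ts t where "set ts \<subseteq> H" "xs = map (skolem_val M a) ts" "t \<in> H" "x = skolem_val M a t"
      by (auto simp: A_def)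
    then show ?case
      by (intro exI[of _ "t # ts"]) simp
  qed simp
  have App: "App s ts \<in> H" if "s \<in> S" "set ts \<subseteq> H" for s ts
    using that by (auto simp: H_def)
  show thesis
  proof
    show "A \<subseteq> univ M"
      using skolem_val_in_univ[OF a] by (auto simp: A_def)
    show "A \<noteq> {}"
      by (auto simp: A_def H_def intro: exI[of _ "Var 0"])
    show "countable A"
      using \<open>countable H\<close> by (simp add: A_def)
    show "fun_int M f xs \<in> A" if f: "f \<in> funs L" and xs: "xs \<in> tuples A (fun_arity L f)" for f xs
    proof -
      obtain ts where ts: "set ts \<subseteq> H" "xs = map (skolem_val M a) ts"
        using lists xs by (auto simp: tuples_def)
      have "xs \<in> tuples (univ M) (fun_arity L f)"
        using xs \<open>A \<subseteq> univ M\<close> by (auto simp: tuples_def)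
      then have "fun_int M f xs \<in> univ M"
        using M f by (auto simp: structure_of_def)
      then have "fun_int M f xs = skolem_val M a (App (Inl f) ts)"
        using ts by simp
      moreover have "App (Inl f) ts \<in> H"
        using f ts by (intro App) (auto simp: S_def)
      ultimately show ?thesis
        by (simp only: A_def image_eqI)
    qed
    show "\<exists>b\<in>A. sat M (e(x := b)) \<phi>"
      if \<phi>: "fm_of L \<phi>" and e: "range e \<subseteq> A" and b: "b \<in> univ M" "sat M (e(x := b)) \<phi>" for \<phi> x e b
    proof -
      \<comment> \<open>Skolem terms have finitely many arguments, so the assignment is cut to a
        list that is long enough for the free variables of \<open>\<phi>\<close>.\<close>
      obtain m where m: "\<forall>i\<in>free_vars \<phi>. i < m"
        using finite_free_vars finite_nat_set_iff_bounded by blast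
      have "set (map e [0..<m]) \<subseteq> A"
        using e by auto
      then obtain ts where ts: "set ts \<subseteq> H" "map e [0..<m] = map (skolem_val M a) ts"
        using lists by blast
      let ?e = "\<lambda>i. map (skolem_val M a) ts ! i"
      have eq: "sat M (e(x := c)) \<phi> \<longleftrightarrow> sat M (?e(x := c)) \<phi>" for c
        using m by (intro sat_cong) (simp flip: ts(2))
      then have "\<exists>b\<in>univ M. sat M (?e(x := b)) \<phi>"
        using b by blast
      from skolem_val_witness(2)[OF a this]
      have "sat M (e(x := skolem_val M a (App (Inr (\<phi>, x)) ts))) \<phi>"
        by (simp only: eq)
      moreover have "App (Inr (\<phi>, x)) ts \<in> H"
        using \<phi> ts by (intro App) (auto simp: S_def)
      ultimately show ?thesis
        unfolding A_def by blast
    qed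
  qed
qed

text \<open>\<open>entails\<close> looks only at models inside \<open>nat\<close>, whereas the given
  model lives on an arbitrary type. A countable elementary substructure, copied into
  \<open>nat\<close>, bridges the gap.\<close>

lemma downward_loewenheim_skolem:
  fixes M :: "('f, 'r, 'a) fo_structure"
  assumes L: "countable_language L" and M: "structure_of L M"
  obtains N :: "('f, 'r, nat) fo_structure"
  where "structure_of L N" "\<And>\<sigma>. sentence L \<sigma> \<Longrightarrow> satisfies N \<sigma> \<longleftrightarrow> satisfies M \<sigma>"
proof -
  obtain A where A: "A \<subseteq> univ M" "A \<noteq> {}" "countable A"
    and clos: "\<And>f xs. f \<in> funs L \<Longrightarrow> xs \<in> tuples A (fun_arity L f) \<Longrightarrow> fun_int M f xs \<in> A"
    and tv: "\<And>\<phi> x e b. fm_of L \<phi> \<Longrightarrow> range e \<subseteq> A \<Longrightarrow> b \<in> univ M \<Longrightarrow> sat M (e(x := b)) \<phi> \<Longrightarrow>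
           \<exists>b\<in>A. sat M (e(x := b)) \<phi>"
    using skolem_hull[OF L M] by metis
  define g where "g = from_nat_into A"
  define c where "c = to_nat_on A"
  have gA: "g n \<in> A" for n
    using A by (simp add: g_def from_nat_into)
  have gc: "g (c a) = a" if "a \<in> A" for a
    using A that by (simp add: g_def c_def)
  define N :: "('f, 'r, nat) fo_structure" where
    "N = \<lparr>univ = c ` A, fun_int = \<lambda>f xs. c (fun_int M f (map g xs)),
          rel_int = \<lambda>R. {xs. map g xs \<in> rel_int M R}\<rparr>"
  have inj: "x = y" if "x \<in> c ` A" "y \<in> c ` A" "g x = g y" for x y
    using that gc by auto
  have tm: "tm_val N e t \<in> c ` A \<and> g (tm_val N e t) = tm_val M (\<lambda>x. g (e x)) t"
    if "tm_of L t" "range e \<subseteq> c ` A" for e t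
    using that(1)
  proof (induction t)
    case (Var x)
    then show ?case
      using that by auto
  next
    case (App f ts)
    have "g (tm_val N e t) = tm_val M (\<lambda>x. g (e x)) t" if "t \<in> set ts" for t
      using App.IH[OF that] App.prems that by simp
    then have eq: "map g (map (tm_val N e) ts) = map (tm_val M (\<lambda>x. g (e x))) ts"
      by simp
    have "map g (map (tm_val N e) ts) \<in> tuples A (fun_arity L f)"
      using App.prems gA by (auto simp: tuples_def)
    then have "fun_int M f (map g (map (tm_val N e) ts)) \<in> A"
      using App.prems clos by simp
    moreover have "tm_val N e (App f ts) = c (fun_int M f (map g (map (tm_val N e) ts)))"
      by (simp add: N_def)
    ultimately show ?case
      using gc eq by (metis imageI tm_val.simps(2))
  qed
  have sat: "sat N e \<phi> \<longleftrightarrow> sat M (\<lambda>x. g (e x)) \<phi>" if "fm_of L \<phi>" "range e \<subseteq> c ` A" for e \<phi>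
    using that
  proof (induction \<phi> arbitrary: e)
    case (Eq s t)
    then show ?case
      using tm inj by (metis fm_of.simps(1) sat.simps(1))
  next
    case (Rel R ts)
    have "g (tm_val N e t) = tm_val M (\<lambda>x. g (e x)) t" if "t \<in> set ts" for t
      using tm[of t e] Rel.prems that by simp
    then have "map g (map (tm_val N e) ts) = map (tm_val M (\<lambda>x. g (e x))) ts"
      by simp
    moreover have "sat N e (Rel R ts) \<longleftrightarrow> map g (map (tm_val N e) ts) \<in> rel_int M R"
      by (simp add: N_def)
    ultimately show ?case
      by (metis sat.simps(2))
  next
    case (Ex x \<phi>)
    have upd: "(\<lambda>y. g ((e(x := n)) y)) = (\<lambda>x. g (e x))(x := g n)" for n
      by (rule ext) simp
    have IH: "sat N (e(x := n)) \<phi> \<longleftrightarrow> sat M ((\<lambda>x. g (e x))(x := g n)) \<phi>" if "n \<in> c ` A" for n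
    proof -
      have "range (e(x := n)) \<subseteq> c ` A"
        using Ex.prems that by auto
      moreover have "fm_of L \<phi>"
        using Ex.prems by simp
      ultimately show ?thesis
        using Ex.IH[of "e(x := n)"] unfolding upd by blast
    qed
    have univN: "univ N = c ` A"
      by (simp add: N_def)
    show ?case
    proof
      assume "sat N e (Ex x \<phi>)"
      then obtain n where "n \<in> c ` A" "sat N (e(x := n)) \<phi>"
        by (auto simp: univN)
      then show "sat M (\<lambda>x. g (e x)) (Ex x \<phi>)"
        using IH gA A(1) by auto
    next
      assume "sat M (\<lambda>x. g (e x)) (Ex x \<phi>)"
      then obtain b where "b \<in> univ M" "sat M ((\<lambda>x. g (e x))(x := b)) \<phi>"
        by auto
      moreover have "range (\<lambda>x. g (e x)) \<subseteq> A"
        using gA by auto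
      ultimately obtain b where "b \<in> A" "sat M ((\<lambda>x. g (e x))(x := b)) \<phi>"
        using tv Ex.prems by (metis fm_of.simps(5))
      then have "sat N (e(x := c b)) \<phi>"
        using IH gc by (metis imageI)
      then show "sat N e (Ex x \<phi>)"
        using \<open>b \<in> A\<close> by (auto simp: univN)
    qed
  qed auto
  show thesis
  proof
    show "structure_of L N"
      unfolding structure_of_def
    proof (intro conjI ballI)
      show "univ N \<noteq> {}"
        using A by (simp add: N_def)
      fix f xs assume "f \<in> funs L" "xs \<in> tuples (univ N) (fun_arity L f)"
      then have "fun_int M f (map g xs) \<in> A"
        using gA by (intro clos) (auto simp: tuples_def)
      then show "fun_int N f xs \<in> univ N"
        by (simp add: N_def)
    qed
    show "satisfies N \<sigma> \<longleftrightarrow> satisfies M \<sigma>" if "sentence L \<sigma>" for \<sigma>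
    proof -
      obtain a where "a \<in> A"
        using A by blast
      then have "sat N (\<lambda>_. c a) \<sigma> \<longleftrightarrow> sat M (\<lambda>_. g (c a)) \<sigma>"
        using that by (intro sat) (auto simp: sentence_def)
      moreover have "univ N \<noteq> {}" "univ M \<noteq> {}"
        using A by (auto simp: N_def)
      ultimately show ?thesis
        using that satisfies_iff_sat unfolding sentence_def by metis
    qed
  qed
qed

lemma entails_satisfies:
  assumes "countable_language L" "\<forall>\<sigma>\<in>T. sentence L \<sigma>" "sentence L \<sigma>"
    and "model_of L T M" "entails L T \<sigma>"
  shows "satisfies M \<sigma>"
proof -
  obtain N :: "('a, 'b, nat) fo_structure" where
    N: "structure_of L N" "\<And>\<sigma>. sentence L \<sigma> \<Longrightarrow> satisfies N \<sigma> \<longleftrightarrow> satisfies M \<sigma>"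
    using downward_loewenheim_skolem assms unfolding model_of_def by metis
  then have "model_of L T N"
    using assms by (auto simp: model_of_def)
  then show ?thesis
    using assms N by (auto simp: entails_def)
qed

section \<open>Independent formulas\<close>

lemma complete_1_typeE:
  assumes "p \<in> complete_1_types L T"
  obtains N :: "('f, 'r, nat) fo_structure" and a
  where "model_of L T N" "a \<in> univ N" "p = {\<phi> \<in> one_formulas L. sat N (\<lambda>_. a) \<phi>}"
proof -
  obtain N :: "('f, 'r, nat) fo_structure" and a where
    N: "model_of L T N" "a \<in> univ N" "\<forall>\<phi>\<in>p. sat N (\<lambda>_. a) \<phi>"
    and p: "p \<subseteq> one_formulas L" "\<forall>\<phi>\<in>one_formulas L. \<phi> \<in> p \<or> Neg \<phi> \<in> p"
    using assms unfolding complete_1_types_def by blast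
  have "p = {\<phi> \<in> one_formulas L. sat N (\<lambda>_. a) \<phi>}"
    using N(3) p by force
  with N show thesis
    using that by blast
qed

lemma one_formulas_simps [simp]:
  "Neg \<phi> \<in> one_formulas L \<longleftrightarrow> \<phi> \<in> one_formulas L"
  "And \<phi> \<psi> \<in> one_formulas L \<longleftrightarrow> \<phi> \<in> one_formulas L \<and> \<psi> \<in> one_formulas L"
  by (auto simp: one_formulas_def)

lemma complete_1_type_simps:
  assumes "p \<in> complete_1_types L T"
  shows "\<phi> \<in> one_formulas L \<Longrightarrow> Neg \<phi> \<in> p \<longleftrightarrow> \<phi> \<notin> p"
    and "And \<phi> \<psi> \<in> p \<longleftrightarrow> \<phi> \<in> p \<and> \<psi> \<in> p"
    and "\<phi> \<in> p \<Longrightarrow> \<phi> \<in> one_formulas L"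
  by (rule complete_1_typeE[OF assms]; auto)+

text \<open>Otherwise the formulas that are consistent with uncountably many of the given types form a
  single type, and all the others lie in countably many countable sets.\<close>

lemma uncountable_types_split:
  assumes L: "countable_language L" and unc: "uncountable {p \<in> complete_1_types L T. \<phi> \<in> p}"
  obtains \<psi> where "\<psi> \<in> one_formulas L"
    and "uncountable {p \<in> complete_1_types L T. And \<phi> \<psi> \<in> p}"
    and "uncountable {p \<in> complete_1_types L T. And \<phi> (Neg \<psi>) \<in> p}"
proof -
  define B where "B \<psi> = {p \<in> complete_1_types L T. And \<phi> \<psi> \<in> p}" for \<psi>
  have "\<exists>\<psi>\<in>one_formulas L. uncountable (B \<psi>) \<and> uncountable (B (Neg \<psi>))"
  proof (rule ccontr)
    define bad where "bad = {\<psi> \<in> one_formulas L. countable (B \<psi>)}"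
    assume contr: "\<not> (\<exists>\<psi>\<in>one_formulas L. uncountable (B \<psi>) \<and> uncountable (B (Neg \<psi>)))"
    have split: "\<psi> \<in> bad \<or> Neg \<psi> \<in> bad" if "\<psi> \<in> one_formulas L" for \<psi>
      using contr that by (auto simp: bad_def)
    have "countable (one_formulas L)"
      by (rule countable_subset[OF _ countable_fm_of[OF L]]) (auto simp: one_formulas_def)
    then have "countable bad"
      by (rule countable_subset[rotated]) (auto simp: bad_def)
    moreover have "countable (B \<psi>)" if "\<psi> \<in> bad" for \<psi>
      using that by (simp add: bad_def)
    ultimately have "countable (insert (one_formulas L - bad) (\<Union>\<psi>\<in>bad. B \<psi>))"
      by simp
    moreover have "{p \<in> complete_1_types L T. \<phi> \<in> p} \<subseteq> insert (one_formulas L - bad) (\<Union>\<psi>\<in>bad. B \<psi>)"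
    proof
      fix p assume p: "p \<in> {p \<in> complete_1_types L T. \<phi> \<in> p}"
      then have p': "p \<in> complete_1_types L T" "\<phi> \<in> p"
        by auto
      note simps = complete_1_type_simps[OF p'(1)]
      show "p \<in> insert (one_formulas L - bad) (\<Union>\<psi>\<in>bad. B \<psi>)"
      proof (cases "p \<inter> bad = {}")
        case True
        have "p = one_formulas L - bad"
        proof (intro equalityI subsetI)
          show "\<psi> \<in> one_formulas L - bad" if "\<psi> \<in> p" for \<psi>
            using True simps(3)[OF that] that by auto
          show "\<psi> \<in> p" if "\<psi> \<in> one_formulas L - bad" for \<psi>
          proof -
            have "Neg \<psi> \<in> bad"
              using split[of \<psi>] that by auto
            then have "Neg \<psi> \<notin> p"
              using True by auto
            then show ?thesis
              using simps(1)[of \<psi>] that by simp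
          qed
        qed
        then show ?thesis
          by simp
      next
        case False
        then obtain \<psi> where "\<psi> \<in> p" "\<psi> \<in> bad"
          by auto
        then have "p \<in> B \<psi>"
          using p' simps(2)[of \<phi> \<psi>] by (simp add: B_def)
        with \<open>\<psi> \<in> bad\<close> show ?thesis
          by blast
      qed
    qed
    ultimately have "countable {p \<in> complete_1_types L T. \<phi> \<in> p}"
      by (rule countable_subset[rotated])
    with unc show False ..
  qed
  then show thesis
    using that unfolding B_def by (elim bexE conjE)
qed

section \<open>Realizing the tree of formulas in the given model\<close>

lemma sat_Ex_one_formula:
  assumes "\<phi> \<in> one_formulas L"
  shows "sat M e (Ex 0 \<phi>) \<longleftrightarrow> (\<exists>a\<in>univ M. sat M (\<lambda>_. a) \<phi>)"
proof -
  have "sat M (e(0 := a)) \<phi> \<longleftrightarrow> sat M (\<lambda>_. a) \<phi>" for a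
    using assms by (intro sat_cong) (auto simp: one_formulas_def)
  then show ?thesis
    by simp
qed

text \<open>\<open>M\<close> may omit the type, but not a single formula of it: the existential
  sentence holds in the model that realizes \<open>p\<close>, so \<open>T\<close> does not entail
  its negation and, being complete, entails the sentence.\<close>

lemma type_formula_realized:
  assumes L: "countable_language L" and T: "complete_theory L T" and M: "model_of L T M"
    and p: "p \<in> complete_1_types L T" "\<phi> \<in> p"
  shows "\<exists>a\<in>univ M. sat M (\<lambda>_. a) \<phi>"
proof -
  obtain N :: "('a, 'b, nat) fo_structure" and b where
    N: "model_of L T N" "b \<in> univ N" "p = {\<phi> \<in> one_formulas L. sat N (\<lambda>_. b) \<phi>}"
    using complete_1_typeE[OF p(1)] .
  have \<phi>: "\<phi> \<in> one_formulas L" "sat N (\<lambda>_. b) \<phi>"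
    using N(3) p(2) by auto
  note Ex = sat_Ex_one_formula[OF \<phi>(1)]
  have sen: "sentence L (Ex 0 \<phi>)"
    using \<phi> by (auto simp: sentence_def one_formulas_def)
  have nonempty: "univ M \<noteq> {}" "univ N \<noteq> {}"
    using M N by (auto simp: model_of_def structure_of_def)
  have "sat N (\<lambda>_. b) (Ex 0 \<phi>)"
    unfolding Ex using \<phi>(2) N(2) by blast
  then have "\<not> sat N (\<lambda>_. b) (Neg (Ex 0 \<phi>))"
    by (simp only: sat.simps(3) not_not)
  moreover have "free_vars (Ex 0 \<phi>) = {}" "free_vars (Neg (Ex 0 \<phi>)) = {}"
    using sen by (simp_all add: sentence_def)
  moreover note satisfies_iff_sat[of "Neg (Ex 0 \<phi>)" N "\<lambda>_. b"] nonempty(2)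
  ultimately have "\<not> satisfies N (Neg (Ex 0 \<phi>))"
    by blast
  then have "\<not> entails L T (Neg (Ex 0 \<phi>))"
    using N(1) unfolding entails_def by blast
  then have "entails L T (Ex 0 \<phi>)"
    using T sen unfolding complete_theory_def by blast
  then have "satisfies M (Ex 0 \<phi>)"
    using entails_satisfies[OF L _ sen M] T unfolding complete_theory_def by blast
  then have "sat M undefined (Ex 0 \<phi>)"
    using satisfies_iff_sat[of "Ex 0 \<phi>" M undefined] \<open>free_vars (Ex 0 \<phi>) = {}\<close> nonempty(1) by blast
  then show ?thesis
    unfolding Ex .
qed

definition unary_definable ::
    "('f, 'r) fo_language \<Rightarrow> ('f, 'r, 'a) fo_structure \<Rightarrow> ('a \<Rightarrow> bool) \<Rightarrow> bool" where
  "unary_definable L M Q \<longleftrightarrow> (\<exists>\<phi>\<in>one_formulas L. \<forall>a\<in>univ M. Q a \<longleftrightarrow> sat M (\<lambda>_. a) \<phi>)"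

lemma unary_definable_finite_disj:
  assumes "finite I" "\<And>i. i \<in> I \<Longrightarrow> unary_definable L M (Q i)"
  shows "unary_definable L M (\<lambda>a. \<exists>i\<in>I. Q i a)"
  using assms
proof (induction I)
  case empty
  show ?case
    unfolding unary_definable_def
    by (intro bexI[of _ "Neg (Eq (Var 0) (Var 0))"]) (auto simp: one_formulas_def)
next
  case (insert i I)
  then have "unary_definable L M (Q i)" "unary_definable L M (\<lambda>a. \<exists>i\<in>I. Q i a)"
    by simp_all
  then obtain \<phi> \<psi> where
    "\<phi> \<in> one_formulas L" "\<forall>a\<in>univ M. Q i a \<longleftrightarrow> sat M (\<lambda>_. a) \<phi>"
    "\<psi> \<in> one_formulas L" "\<forall>a\<in>univ M. (\<exists>i\<in>I. Q i a) \<longleftrightarrow> sat M (\<lambda>_. a) \<psi>"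
    unfolding unary_definable_def by blast
  then show ?case
    unfolding unary_definable_def
    by (intro bexI[of _ "Neg (And (Neg \<phi>) (Neg \<psi>))"]) simp_all
qed

text \<open>Splitting repeatedly gives a binary tree of formulas; the bits of the branch through an element
  are independent.\<close>

lemma independent_definable_sets:
  fixes M :: "('f, 'r, 'a) fo_structure"
  assumes L: "countable_language L" and T: "complete_theory L T" and M: "model_of L T M"
    and unc: "uncountable (complete_1_types L T)"
  obtains \<beta> :: "nat \<Rightarrow> 'a \<Rightarrow> bool"
  where "\<And>n. unary_definable L M (\<beta> n)"
    and "\<And>b F. finite F \<Longrightarrow> \<exists>a\<in>univ M. \<forall>n\<in>F. \<beta> n a = b n"
proof -
  define big where "big \<phi> \<longleftrightarrow> uncountable {p \<in> complete_1_types L T. \<phi> \<in> p}" for \<phi>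
  have "\<forall>\<phi>. \<exists>\<psi>. big \<phi> \<longrightarrow> \<psi> \<in> one_formulas L \<and> big (And \<phi> \<psi>) \<and> big (And \<phi> (Neg \<psi>))"
  proof (intro allI)
    fix \<phi>
    show "\<exists>\<psi>. big \<phi> \<longrightarrow> \<psi> \<in> one_formulas L \<and> big (And \<phi> \<psi>) \<and> big (And \<phi> (Neg \<psi>))"
    proof (cases "big \<phi>")
      case True
      obtain \<psi> where "\<psi> \<in> one_formulas L" "big (And \<phi> \<psi>)" "big (And \<phi> (Neg \<psi>))"
        using uncountable_types_split[OF L True[unfolded big_def]] unfolding big_def .
      then show ?thesis
        by (intro exI[of _ \<psi>]) simp
    qed simp
  qed
  from choice[OF this] obtain spl where "\<forall>\<phi>. big \<phi> \<longrightarrow>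
      spl \<phi> \<in> one_formulas L \<and> big (And \<phi> (spl \<phi>)) \<and> big (And \<phi> (Neg (spl \<phi>)))" ..
  then have spl: "\<And>\<phi>. big \<phi> \<Longrightarrow> spl \<phi> \<in> one_formulas L"
    "\<And>\<phi>. big \<phi> \<Longrightarrow> big (And \<phi> (spl \<phi>))" "\<And>\<phi>. big \<phi> \<Longrightarrow> big (And \<phi> (Neg (spl \<phi>)))"
    by simp_all
  \<comment> \<open>Nodes are lists of decisions with the latest one at the head. The root is the
    trivial formula, and \<open>path a n\<close> is the node of level \<open>n\<close> whose formula
    \<open>a\<close> satisfies.\<close>
  define node where
    "node = rec_list (Eq (Var 0) (Var 0))
       (\<lambda>b _ \<phi>. And \<phi> (if b then spl \<phi> else Neg (spl \<phi>)))"
  define path :: "'a \<Rightarrow> nat \<Rightarrow> bool list" where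
    "path a = rec_nat [] (\<lambda>_ s. sat M (\<lambda>_. a) (spl (node s)) # s)" for a
  have node: "node [] = Eq (Var 0) (Var 0)"
    "node (b # s) = And (node s) (if b then spl (node s) else Neg (spl (node s)))" for b s
    by (simp_all add: node_def)
  have path: "path a 0 = []" "path a (Suc n) = sat M (\<lambda>_. a) (spl (node (path a n))) # path a n" for a n
    by (simp_all add: path_def)
  have length_path: "length (path a n) = n" for a n
    by (induction n) (simp_all add: path)
  have big: "big (node s)" for s
  proof (induction s)
    case Nil
    have "node [] \<in> p" if "p \<in> complete_1_types L T" for p
      using that by (rule complete_1_typeE) (auto simp: node one_formulas_def)
    then have "{p \<in> complete_1_types L T. node [] \<in> p} = complete_1_types L T"
      by blast
    then show ?case
      using unc by (simp add: big_def)
  qed (simp add: node spl)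
  have sat_node: "sat M (\<lambda>_. a) (node s) \<longleftrightarrow> path a (length s) = s" for a s
    by (induction s) (auto simp: node path)
  have one: "node s \<in> one_formulas L" for s
  proof (induction s)
    case Nil
    show ?case
      by (simp add: node one_formulas_def)
  next
    case (Cons b s)
    then show ?case
      using spl(1)[OF big[of s]] by (simp add: node)
  qed
  have realized: "\<exists>a\<in>univ M. path a (length s) = s" for s
  proof -
    have "{p \<in> complete_1_types L T. node s \<in> p} \<noteq> {}"
      using big[of s] unfolding big_def by (metis countable_empty)
    then obtain p where "p \<in> complete_1_types L T" "node s \<in> p"
      by blast
    then show ?thesis
      using type_formula_realized[OF L T M] unfolding sat_node[symmetric] by blast
  qed
  \<comment> \<open>The splitting formulas depend on the node and need not be independent of each
    other. The turn taken at level \<open>n\<close>, at whichever node, is independent of the other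
    turns because every node is realized.\<close>
  define \<beta> where "\<beta> n a = hd (path a (Suc n))" for n a
  show thesis
  proof
    fix n
    have "unary_definable L M (\<lambda>a. \<exists>s\<in>{s. length s = Suc n \<and> hd s}. sat M (\<lambda>_. a) (node s))"
    proof (rule unary_definable_finite_disj)
      have "finite {s :: bool list. set s \<subseteq> UNIV \<and> length s = Suc n}"
        by (rule finite_lists_length_eq) simp
      then show "finite {s :: bool list. length s = Suc n \<and> hd s}"
        by (rule rev_finite_subset) auto
      show "unary_definable L M (\<lambda>a. sat M (\<lambda>_. a) (node s))" for s
        unfolding unary_definable_def using one by blast
    qed
    moreover have "(\<lambda>a. \<exists>s\<in>{s. length s = Suc n \<and> hd s}. sat M (\<lambda>_. a) (node s)) = \<beta> n"
    proof
      fix a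
      show "(\<exists>s\<in>{s. length s = Suc n \<and> hd s}. sat M (\<lambda>_. a) (node s)) = \<beta> n a"
        unfolding sat_node \<beta>_def
      proof
        assume "hd (path a (Suc n))"
        then show "\<exists>s\<in>{s. length s = Suc n \<and> hd s}. path a (length s) = s"
          by (intro bexI[of _ "path a (Suc n)"]) (simp_all only: length_path mem_Collect_eq simp_thms)
      qed auto
    qed
    ultimately show "unary_definable L M (\<beta> n)"
      by simp
  next
    fix b :: "nat \<Rightarrow> bool" and F :: "nat set"
    assume "finite F"
    then obtain m where m: "\<forall>n\<in>F. n < m"
      using finite_nat_set_iff_bounded by blast
    \<comment> \<open>The branch that takes the prescribed turns, latest first. Reaching it at level
      \<open>m\<close> fixes all lower levels, because shorter paths are tails of longer
      ones.\<close>
    define s where "s n = rev (map b [0..<n])" for n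
    obtain a where a: "a \<in> univ M" "path a m = s m"
      using realized[of "s m"] by (auto simp: s_def)
    have tail: "path a (m - n) = s (m - n)" if "n \<le> m" for n
      using that
    proof (induction n)
      case (Suc n)
      then have m: "m - n = Suc (m - Suc n)"
        by simp
      have "tl (path a (m - n)) = tl (s (m - n))"
        using Suc by simp
      then show ?case
        unfolding m by (simp add: path s_def)
    qed (use a in simp)
    have "\<beta> n a = b n" if "n \<in> F" for n
    proof -
      have "n < m" using m that by blast
      then have "path a (Suc n) = s (Suc n)"
        using tail[of "m - Suc n"] by simp
      then show ?thesis
        by (simp add: \<beta>_def s_def)
    qed
    then show "\<exists>a\<in>univ M. \<forall>n\<in>F. \<beta> n a = b n"
      using a by blast
  qed
qed

section \<open>Structures with rich coordinates\<close>

definition coord_language :: "(nat, nat) fo_language" where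
  "coord_language = \<lparr>funs = {}, fun_arity = \<lambda>_. 0, rels = UNIV, rel_arity = \<lambda>_. 2\<rparr>"

text \<open>The \<open>k\<close>-th relation says that the \<open>k\<close>-th coordinates agree and are not 0: only the value 0 is
  definable, the others are indiscernible.\<close>

definition coord_structure :: "'a set \<Rightarrow> ('a \<Rightarrow> nat \<Rightarrow> nat) \<Rightarrow> (nat, nat, 'a) fo_structure" where
  "coord_structure A d = \<lparr>univ = A, fun_int = \<lambda>_ _. undefined,
     rel_int = \<lambda>k. {[x, y] | x y. d x k = d y k \<and> d x k \<noteq> 0}\<rparr>"

text \<open>Only finite patterns are prescribed, never a whole sequence; so countable sets can be
  rich, and finite independence suffices to obtain richness in \<open>M\<close>.\<close>

definition rich :: "'a set \<Rightarrow> ('a \<Rightarrow> nat \<Rightarrow> nat) \<Rightarrow> bool" where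
  "rich A d \<longleftrightarrow> (\<forall>a\<in>A. \<forall>k. d a k \<le> Suc k) \<and>
     (\<forall>K v. (\<forall>k. v k \<le> Suc k) \<longrightarrow> (\<exists>a\<in>A. \<forall>k<K. d a k = v k))"

lemma coord_structure_simps [simp]:
  "univ (coord_structure A d) = A"
  "[x, y] \<in> rel_int (coord_structure A d) k \<longleftrightarrow> d x k = d y k \<and> d x k \<noteq> 0"
  by (auto simp: coord_structure_def)

lemma tm_of_coord_language: "tm_of coord_language t \<longleftrightarrow> (\<exists>i. t = Var i)"
  by (cases t) (auto simp: coord_language_def)

lemma fm_of_coord_language_Rel:
  "fm_of coord_language (Rel k ts) \<longleftrightarrow> (\<exists>i j. ts = [Var i, Var j])"
proof -
  have "rels coord_language = UNIV" "rel_arity coord_language k = 2"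
    by (simp_all add: coord_language_def)
  then show ?thesis
    by (auto simp: tm_of_coord_language length_Suc_conv numeral_2_eq_2)
qed

lemma structure_of_coord_structure: "A \<noteq> {} \<Longrightarrow> structure_of coord_language (coord_structure A d)"
  by (simp add: structure_of_def coord_language_def)

text \<open>A coordinate \<open>m \<ge> K\<close> is unconstrained on the set and takes
  \<open>m + 2\<close> values there, which is too many once \<open>m\<close> is at least the
  supposed cardinality. This supplies fresh elements for the back and forth.\<close>

lemma rich_infinite:
  assumes "rich A d" "\<And>k. v k \<le> Suc k"
  shows "infinite {a \<in> A. \<forall>k<K. d a k = v k}" (is "infinite ?X")
proof
  assume fin: "finite ?X"
  define m where "m = max K (card ?X)"
  have "{..Suc m} \<subseteq> (\<lambda>a. d a m) ` ?X"
  proof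
    fix t assume "t \<in> {..Suc m}"
    then have "\<forall>k. (v(m := t)) k \<le> Suc k"
      using assms by auto
    then obtain a where a: "a \<in> A" "\<forall>k<Suc m. d a k = (v(m := t)) k"
      using assms(1) unfolding rich_def by blast
    then have "a \<in> ?X" "d a m = t"
      by (auto simp: m_def)
    then show "t \<in> (\<lambda>a. d a m) ` ?X"
      by blast
  qed
  then have "card {..Suc m} \<le> card ?X"
    using fin surj_card_le by blast
  then show False
    by (simp add: m_def)
qed

text \<open>A position in the back-and-forth game that sees only the first \<open>K\<close>
  coordinates. Equality of the values is more than the relations can express, but it is easy to
  maintain.\<close>

definition similar ::
    "nat \<Rightarrow> nat set \<Rightarrow> 'a set \<Rightarrow> ('a \<Rightarrow> nat \<Rightarrow> nat) \<Rightarrow> (nat \<Rightarrow> 'a) \<Rightarrow>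
     'b set \<Rightarrow> ('b \<Rightarrow> nat \<Rightarrow> nat) \<Rightarrow> (nat \<Rightarrow> 'b) \<Rightarrow> bool" where
  "similar K V A d e B d' e' \<longleftrightarrow>
     (\<forall>i\<in>V. e i \<in> A \<and> e' i \<in> B \<and> (\<forall>k<K. d (e i) k = d' (e' i) k)) \<and>
     (\<forall>i\<in>V. \<forall>j\<in>V. e i = e j \<longleftrightarrow> e' i = e' j)"

lemma similar_sym: "similar K V A d e B d' e' \<longleftrightarrow> similar K V B d' e' A d e"
  by (auto simp: similar_def)

lemma similar_mono: "similar K V A d e B d' e' \<Longrightarrow> W \<subseteq> V \<Longrightarrow> similar K W A d e B d' e'"
  by (simp add: similar_def subset_iff)

lemma similar_insert:
  assumes sim: "similar K V A d e B d' e'" and x: "x \<notin> V"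
    and ab: "a \<in> A" "b \<in> B" "\<forall>k<K. d a k = d' b k" "\<forall>j\<in>V. e j = a \<longleftrightarrow> e' j = b"
  shows "similar K (insert x V) A d (e(x := a)) B d' (e'(x := b))"
  unfolding similar_def
proof (intro conjI)
  show "\<forall>i\<in>insert x V. (e(x := a)) i \<in> A \<and> (e'(x := b)) i \<in> B \<and>
      (\<forall>k<K. d ((e(x := a)) i) k = d' ((e'(x := b)) i) k)"
    using sim ab(1,2,3) by (simp add: similar_def)
  have "(e(x := a)) i = (e(x := a)) j \<longleftrightarrow> (e'(x := b)) i = (e'(x := b)) j"
    if ij: "i \<in> insert x V" "j \<in> insert x V" for i j
  proof -
    consider "i = x" "j = x" | "i = x" "j \<noteq> x" "j \<in> V" | "i \<noteq> x" "i \<in> V" "j = x"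
      | "i \<noteq> x" "i \<in> V" "j \<noteq> x" "j \<in> V"
      using ij by blast
    then show ?thesis
    proof cases
      case 2
      then show ?thesis
        using ab(4) by (simp add: eq_commute[of a] eq_commute[of b])
    next
      case 4
      then show ?thesis
        using sim by (simp add: similar_def)
    qed (use ab(4) in simp_all)
  qed
  then show "\<forall>i\<in>insert x V. \<forall>j\<in>insert x V.
      (e(x := a)) i = (e(x := a)) j \<longleftrightarrow> (e'(x := b)) i = (e'(x := b)) j"
    by blast
qed

text \<open>An element already in play has its partner. A new one is answered by an element with the
  same first \<open>K\<close> coordinates, of which there are infinitely many, while only finitely
  many are in use.\<close>

lemma similar_extend:
  assumes sim: "similar K V A d e B d' e'" and "finite V" and "x \<notin> V"
    and A: "rich A d" and B: "rich B d'" and a: "a \<in> A"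
  shows "\<exists>b\<in>B. similar K (insert x V) A d (e(x := a)) B d' (e'(x := b))"
proof (cases "\<exists>j\<in>V. e j = a")
  case True
  then obtain j where j: "j \<in> V" "e j = a"
    by blast
  have "e' j \<in> B" "\<forall>k<K. d (e j) k = d' (e' j) k" "\<forall>i\<in>V. e i = e j \<longleftrightarrow> e' i = e' j"
    using sim j(1) by (simp_all add: similar_def)
  then show ?thesis
    using similar_insert[OF sim \<open>x \<notin> V\<close> a, of "e' j"] unfolding j(2) by (intro bexI[of _ "e' j"])
next
  case False
  have "infinite {b \<in> B. \<forall>k<K. d' b k = d a k}"
    using A a by (intro rich_infinite[OF B]) (simp add: rich_def)
  then have "infinite ({b \<in> B. \<forall>k<K. d' b k = d a k} - e' ` V)"
    using \<open>finite V\<close> by simp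
  then have "{b \<in> B. \<forall>k<K. d' b k = d a k} - e' ` V \<noteq> {}"
    by (metis finite.emptyI)
  then obtain b where b: "b \<in> B" "\<forall>k<K. d' b k = d a k" "b \<notin> e' ` V"
    by blast
  then have "\<forall>k<K. d a k = d' b k"
    by simp
  moreover have "\<forall>j\<in>V. e j = a \<longleftrightarrow> e' j = b"
    using False b(3) by blast
  ultimately show ?thesis
    using similar_insert[OF sim \<open>x \<notin> V\<close> a b(1)] b(1) by (intro bexI[of _ b])
qed

text \<open>A formula mentions finitely many relations, so one \<open>K\<close> serves throughout
  the induction; similar positions can be extended without lowering it.\<close>

lemma sat_coord_structure_cong:
  assumes A: "rich A d" and B: "rich B d'"
  shows "fm_of coord_language \<phi> \<Longrightarrow> \<forall>k\<in>set2_fm \<phi>. k < K \<Longrightarrow>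
    similar K (free_vars \<phi>) A d e B d' e' \<Longrightarrow>
    sat (coord_structure A d) e \<phi> \<longleftrightarrow> sat (coord_structure B d') e' \<phi>"
proof (induction \<phi> arbitrary: e e')
  case (Eq s t)
  then obtain i j where ij: "s = Var i" "t = Var j"
    using tm_of_coord_language by auto
  then have "e i = e j \<longleftrightarrow> e' i = e' j"
    using Eq.prems(3) unfolding similar_def by simp
  then show ?case
    by (simp add: ij)
next
  case (Rel k ts)
  then obtain i j where ij: "ts = [Var i, Var j]"
    using fm_of_coord_language_Rel by blast
  then have "d (e i) k = d' (e' i) k" "d (e j) k = d' (e' j) k"
    using Rel.prems(2,3) by (simp_all add: similar_def)
  then show ?case
    by (simp add: ij)
next
  case (And \<phi> \<psi>)
  have "similar K (free_vars \<phi>) A d e B d' e'" "similar K (free_vars \<psi>) A d e B d' e'"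
    by (rule similar_mono[OF And.prems(3)]; simp)+
  then have "sat (coord_structure A d) e \<phi> \<longleftrightarrow> sat (coord_structure B d') e' \<phi>"
    "sat (coord_structure A d) e \<psi> \<longleftrightarrow> sat (coord_structure B d') e' \<psi>"
    using And.prems(1,2) by (intro And.IH; simp)+
  then show ?case
    by simp
next
  case (Neg \<phi>)
  have "sat (coord_structure A d) e \<phi> \<longleftrightarrow> sat (coord_structure B d') e' \<phi>"
    using Neg.prems by (intro Neg.IH) simp_all
  then show ?case
    by simp
next
  case (Ex x \<phi>)
  let ?V = "free_vars \<phi> - {x}"
  have V: "finite ?V" "x \<notin> ?V" "free_vars \<phi> \<subseteq> insert x ?V"
    by (auto simp: finite_free_vars)
  have IH: "sat (coord_structure A d) f \<phi> \<longleftrightarrow> sat (coord_structure B d') f' \<phi>"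
    if "similar K (insert x ?V) A d f B d' f'" for f f'
    using Ex.prems by (intro Ex.IH similar_mono[OF that V(3)]) auto
  have sim: "similar K ?V A d e B d' e'"
    using Ex.prems by simp
  show ?case
  proof
    assume "sat (coord_structure A d) e (Ex x \<phi>)"
    then obtain a where a: "a \<in> A" "sat (coord_structure A d) (e(x := a)) \<phi>"
      by auto
    obtain b where b: "b \<in> B" "similar K (insert x ?V) A d (e(x := a)) B d' (e'(x := b))"
      using similar_extend[OF sim V(1,2) A B a(1)] by blast
    have "sat (coord_structure B d') (e'(x := b)) \<phi>"
      using IH[OF b(2)] a(2) by simp
    then show "sat (coord_structure B d') e' (Ex x \<phi>)"
      using b(1) by auto
  next
    assume "sat (coord_structure B d') e' (Ex x \<phi>)"
    then obtain b where b: "b \<in> B" "sat (coord_structure B d') (e'(x := b)) \<phi>"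
      by auto
    obtain a where a: "a \<in> A" "similar K (insert x ?V) B d' (e'(x := b)) A d (e(x := a))"
      using similar_extend[OF similar_sym[THEN iffD1, OF sim] V(1,2) B A b(1)] by blast
    have "sat (coord_structure A d) (e(x := a)) \<phi>"
      using IH[OF similar_sym[THEN iffD1, OF a(2)]] b(2) by simp
    then show "sat (coord_structure A d) e (Ex x \<phi>)"
      using a(1) by auto
  qed
qed

lemma rich_nonempty:
  assumes "rich A d"
  shows "A \<noteq> {}"
proof -
  have "\<exists>a\<in>A. \<forall>k<0. d a k = 0"
    using assms unfolding rich_def by (elim conjE allE[of _ 0] allE[of _ "\<lambda>_. 0"]) simp
  then show ?thesis
    by blast
qed

text \<open>For a sentence the similarity condition is empty. Thus all rich structures are
  elementarily equivalent, and codes on \<open>nat\<close> are models of the theory of the reduct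
  however large \<open>M\<close> is.\<close>

lemma model_of_Th_coord_structure:
  assumes A: "rich A d" and B: "rich B d'"
  shows "model_of coord_language (Th coord_language (coord_structure A d)) (coord_structure B d')"
  unfolding model_of_def
proof (intro conjI ballI)
  show "structure_of coord_language (coord_structure B d')"
    using B by (intro structure_of_coord_structure rich_nonempty)
  fix \<sigma> assume \<sigma>: "\<sigma> \<in> Th coord_language (coord_structure A d)"
  then have sen: "free_vars \<sigma> = {}" "fm_of coord_language \<sigma>" "satisfies (coord_structure A d) \<sigma>"
    by (auto simp: Th_def sentence_def)
  have "finite (set2_fm \<sigma>)"
    by (rule fm.set_finite)
  then obtain K where "\<forall>k\<in>set2_fm \<sigma>. k < K"
    using finite_nat_set_iff_bounded by blast
  then have "sat (coord_structure A d) undefined \<sigma> \<longleftrightarrow> sat (coord_structure B d') undefined \<sigma>"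
    using sen by (intro sat_coord_structure_cong[OF A B]) (auto simp: similar_def)
  then show "satisfies (coord_structure B d') \<sigma>"
    using sen rich_nonempty[OF A] rich_nonempty[OF B] by (metis satisfies_iff_sat coord_structure_simps(1))
qed

section \<open>The reduct\<close>

lemma solution_set_simps:
  "solution_set M k (Neg \<phi>) = tuples (univ M) k - solution_set M k \<phi>"
  "solution_set M k (And \<phi> \<psi>) = solution_set M k \<phi> \<inter> solution_set M k \<psi>"
  by (auto simp: solution_set_def)

lemma definable_Diff: "definable L M k D \<Longrightarrow> definable L M k (tuples (univ M) k - D)"
  unfolding definable_def by (metis fm_of.simps(3) free_vars.simps(3) solution_set_simps(1))

lemma definable_Int: "definable L M k D \<Longrightarrow> definable L M k E \<Longrightarrow> definable L M k (D \<inter> E)"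
  unfolding definable_def
  by (metis Un_least fm_of.simps(4) free_vars.simps(4) solution_set_simps(2))

text \<open>The tautology has to be closed, since no free variable is allowed for
  \<open>k = 0\<close>.\<close>

lemma definable_tuples: "definable L M k (tuples (univ M) k)"
  unfolding definable_def
  by (rule exI[of _ "Neg (Ex 0 (Neg (Eq (Var 0) (Var 0))))"]) (auto simp: solution_set_def)

lemma definable_subset: "definable L M k D \<Longrightarrow> D \<subseteq> tuples (univ M) k"
  by (auto simp: definable_def solution_set_def)

lemma definable_Un:
  assumes "definable L M k D" "definable L M k E"
  shows "definable L M k (D \<union> E)"
proof -
  let ?U = "tuples (univ M) k"
  have "D \<union> E = ?U - (?U - D) \<inter> (?U - E)"
    using assms[THEN definable_subset] by blast
  then show ?thesis
    using assms by (metis definable_Diff definable_Int)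
qed

lemma definable_UN:
  assumes "finite I" "\<And>i. i \<in> I \<Longrightarrow> definable L M k (D i)"
  shows "definable L M k (\<Union>i\<in>I. D i)"
  using assms
proof (induction I)
  case empty
  then show ?case
    using definable_Diff[OF definable_tuples, of L M k] by simp
qed (simp add: definable_Un)

lemma definable_INT:
  assumes "finite I" "\<And>i. i \<in> I \<Longrightarrow> definable L M k (D i)"
  shows "definable L M k (tuples (univ M) k \<inter> (\<Inter>i\<in>I. D i))"
  using assms
proof (induction I)
  case empty
  then show ?case
    using definable_tuples by simp
next
  case (insert i I)
  have "definable L M k (D i)" "definable L M k (tuples (univ M) k \<inter> (\<Inter>i\<in>I. D i))"
    using insert by simp_all
  then have "definable L M k (D i \<inter> (tuples (univ M) k \<inter> (\<Inter>i\<in>I. D i)))"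
    by (rule definable_Int)
  then show ?case
    by (simp add: Int_left_commute)
qed

text \<open>Quantifying the variable 0 away renames it to \<open>i\<close> without capture.\<close>

lemma definable_coordinate:
  assumes "unary_definable L M Q" "i < k"
  shows "definable L M k {xs \<in> tuples (univ M) k. Q (xs ! i)}"
proof -
  obtain \<phi> where \<phi>: "fm_of L \<phi>" "free_vars \<phi> \<subseteq> {0}" "\<forall>a\<in>univ M. Q a \<longleftrightarrow> sat M (\<lambda>_. a) \<phi>"
    using assms(1) by (auto simp: unary_definable_def one_formulas_def)
  \<comment> \<open>For \<open>i = 0\<close> the quantifier would bind \<open>Var i\<close>
    itself.\<close>
  define \<psi> where "\<psi> = (if i = 0 then \<phi> else Ex 0 (And (Eq (Var 0) (Var i)) \<phi>))"
  have cong: "sat M e \<phi> \<longleftrightarrow> sat M (\<lambda>_. e 0) \<phi>" for e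
    using \<phi> by (intro sat_cong) auto
  have "Q (xs ! i) \<longleftrightarrow> sat M (\<lambda>i. xs ! i) \<psi>" if "xs \<in> tuples (univ M) k" for xs
  proof -
    have mem: "xs ! i \<in> univ M"
      using that assms(2) by (auto simp: tuples_def)
    then have "sat M (\<lambda>i. xs ! i) \<psi> \<longleftrightarrow> sat M (\<lambda>_. xs ! i) \<phi>"
      using cong[of "\<lambda>i. xs ! i"] cong[of "(\<lambda>i. xs ! i)(0 := xs ! i)"] by (auto simp: \<psi>_def)
    then show ?thesis
      using \<phi>(3) mem by blast
  qed
  then have "{xs \<in> tuples (univ M) k. Q (xs ! i)} = solution_set M k \<psi>"
    by (auto simp: solution_set_def)
  moreover have "fm_of L \<psi>" "free_vars \<psi> \<subseteq> {..<k}"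
    using \<phi> assms(2) by (auto simp: \<psi>_def)
  ultimately show ?thesis
    unfolding definable_def by blast
qed

lemma definable_eq:
  assumes "i < k" "j < k"
  shows "definable L M k {xs \<in> tuples (univ M) k. xs ! i = xs ! j}"
  unfolding definable_def using assms
  by (intro exI[of _ "Eq (Var i) (Var j)"]) (auto simp: solution_set_def)

text \<open>The \<open>k\<close>-th coordinate counts the positive ones among a block of \<open>k + 1\<close> bits.\<close>

definition count_coord :: "(nat \<Rightarrow> 'a \<Rightarrow> bool) \<Rightarrow> 'a \<Rightarrow> nat \<Rightarrow> nat" where
  "count_coord \<beta> a k = card {j. j \<le> k \<and> \<beta> (prod_encode (k, j)) a}"

lemma rich_count_coord:
  assumes "\<And>b F. finite F \<Longrightarrow> \<exists>a\<in>A. \<forall>n\<in>F. \<beta> n a = b n"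
  shows "rich A (count_coord \<beta>)"
  unfolding rich_def
proof (intro conjI ballI allI impI)
  fix a k
  have "card {j. j \<le> k \<and> \<beta> (prod_encode (k, j)) a} \<le> card {..k}"
    by (intro card_mono) auto
  then show "count_coord \<beta> a k \<le> Suc k"
    by (simp add: count_coord_def)
next
  fix K :: nat and v :: "nat \<Rightarrow> nat"
  assume v: "\<forall>k. v k \<le> Suc k"
  have "finite (prod_encode ` ({..<K} \<times> {..K}))"
    by simp
  \<comment> \<open>In block \<open>k\<close> exactly the first \<open>v k\<close> bits are made
    positive; there are enough of them as \<open>v k \<le> k + 1\<close>.\<close>
  from assms[OF this, of "\<lambda>n. case prod_decode n of (k, j) \<Rightarrow> j < v k"]
  obtain a where a: "a \<in> A"
    "\<forall>n \<in> prod_encode ` ({..<K} \<times> {..K}). \<beta> n a = (case prod_decode n of (k, j) \<Rightarrow> j < v k)"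
    by (elim bexE)
  have "count_coord \<beta> a k = v k" if "k < K" for k
  proof -
    have bit: "\<beta> (prod_encode (k, j)) a \<longleftrightarrow> j < v k" if "j \<le> k" for j
      using bspec[OF a(2), of "prod_encode (k, j)"] that \<open>k < K\<close> by simp
    have "v k \<le> Suc k"
      using v ..
    then have "{j. j \<le> k \<and> \<beta> (prod_encode (k, j)) a} = {..<v k}"
      by (auto simp: bit)
    then show ?thesis
      by (simp add: count_coord_def)
  qed
  then show "\<exists>a\<in>A. \<forall>k<K. count_coord \<beta> a k = v k"
    using a by blast
qed

text \<open>The union runs over the finitely many possible sets \<open>S\<close> of positive bits in
  the block, and each bit pattern is a finite Boolean combination of definable sets.\<close>

lemma definable_count_coord_eq:
  assumes \<beta>: "\<And>n. unary_definable L M (\<beta> n)" and "i < k"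
  shows "definable L M k {xs \<in> tuples (univ M) k. count_coord \<beta> (xs ! i) r = v}"
proof -
  let ?U = "tuples (univ M) k"
  let ?B = "\<lambda>S j. {xs \<in> ?U. \<beta> (prod_encode (r, j)) (xs ! i) \<longleftrightarrow> j \<in> S}"
  have "definable L M k (?B S j)" for S j
  proof -
    have D: "definable L M k {xs \<in> ?U. \<beta> (prod_encode (r, j)) (xs ! i)}"
      by (rule definable_coordinate[OF \<beta> \<open>i < k\<close>])
    have "?B S j = (if j \<in> S then {xs \<in> ?U. \<beta> (prod_encode (r, j)) (xs ! i)}
        else ?U - {xs \<in> ?U. \<beta> (prod_encode (r, j)) (xs ! i)})"
      by auto
    then show ?thesis
      using D definable_Diff[OF D] by simp
  qed
  then have "definable L M k (\<Union>S\<in>{S. S \<subseteq> {..r} \<and> card S = v}. ?U \<inter> (\<Inter>j\<in>{..r}. ?B S j))"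
    by (intro definable_UN definable_INT) auto
  moreover have "{xs \<in> ?U. count_coord \<beta> (xs ! i) r = v} =
      (\<Union>S\<in>{S. S \<subseteq> {..r} \<and> card S = v}. ?U \<inter> (\<Inter>j\<in>{..r}. ?B S j))" (is "?L = ?R")
  proof
    show "?L \<subseteq> ?R"
    proof
      fix xs assume "xs \<in> ?L"
      then show "xs \<in> ?R"
        by (intro UN_I[of "{j. j \<le> r \<and> \<beta> (prod_encode (r, j)) (xs ! i)}"])
          (auto simp: count_coord_def)
    qed
    show "?R \<subseteq> ?L"
    proof
      fix xs assume "xs \<in> ?R"
      then obtain S where S: "S \<subseteq> {..r}" "card S = v" "xs \<in> ?U"
        "\<forall>j\<le>r. \<beta> (prod_encode (r, j)) (xs ! i) \<longleftrightarrow> j \<in> S"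
        by auto
      then have "{j. j \<le> r \<and> \<beta> (prod_encode (r, j)) (xs ! i)} = S"
        by auto
      then show "xs \<in> ?L"
        using S by (simp add: count_coord_def)
    qed
  qed
  ultimately show ?thesis
    by simp
qed

lemma reduct_coord_structure:
  assumes M: "structure_of L M" and \<beta>: "\<And>n. unary_definable L M (\<beta> n)"
    and rich: "rich (univ M) (count_coord \<beta>)"
  shows "reduct L M coord_language (coord_structure (univ M) (count_coord \<beta>))"
  unfolding reduct_def
proof (intro conjI allI impI)
  show "countable_language coord_language"
    by (simp add: countable_language_def coord_language_def)
  show "structure_of coord_language (coord_structure (univ M) (count_coord \<beta>))"
    using M by (intro structure_of_coord_structure) (simp add: structure_of_def)
  let ?M' = "coord_structure (univ M) (count_coord \<beta>)"
  fix \<alpha> :: "(nat, nat) fm" and k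
  assume "atomic \<alpha> \<and> fm_of coord_language \<alpha> \<and> free_vars \<alpha> \<subseteq> {..<k}"
  then have \<alpha>: "atomic \<alpha>" "fm_of coord_language \<alpha>" "free_vars \<alpha> \<subseteq> {..<k}"
    by auto
  show "definable L M k (solution_set ?M' k \<alpha>)"
  proof (cases \<alpha>)
    case (Eq s t)
    then obtain i j where ij: "s = Var i" "t = Var j"
      using \<alpha> tm_of_coord_language by auto
    then have "solution_set ?M' k \<alpha> = {xs \<in> tuples (univ M) k. xs ! i = xs ! j}"
      by (simp add: Eq solution_set_def)
    then show ?thesis
      using definable_eq[of i k j] \<alpha> Eq ij by simp
  next
    case (Rel r ts)
    then obtain i j where ij: "ts = [Var i, Var j]"
      using \<alpha> fm_of_coord_language_Rel by blast
    let ?D = "\<lambda>i v. {xs \<in> tuples (univ M) k. count_coord \<beta> (xs ! i) r = v}"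
    have "count_coord \<beta> (xs ! i) r \<le> Suc r" if "xs \<in> tuples (univ M) k" for xs
    proof -
      have "xs ! i \<in> univ M"
        using that \<alpha>(3) Rel ij by (auto simp: tuples_def)
      then show ?thesis
        using rich by (simp add: rich_def)
    qed
    \<comment> \<open>The common value ranges from 1, as 0 is excluded from the relations, to the
      bound given by richness, which makes the union finite.\<close>
    then have "solution_set ?M' k \<alpha> = (\<Union>v\<in>{1..Suc r}. ?D i v \<inter> ?D j v)"
      by (fastforce simp: Rel ij solution_set_def)
    moreover have "definable L M k (\<Union>v\<in>{1..Suc r}. ?D i v \<inter> ?D j v)"
      using \<alpha> Rel ij by (intro definable_UN definable_Int definable_count_coord_eq[OF \<beta>]) auto
    ultimately show ?thesis
      by simp
  qed (use \<alpha> in auto)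
qed simp

section \<open>Coding relations by coordinates\<close>

text \<open>The second component of the decoded pair is discarded, so that each slot owns infinitely
  many coordinates and survives every finite modification.\<close>

definition slot :: "nat \<Rightarrow> 's::countable" where
  "slot k = from_nat (fst (prod_decode k))"

text \<open>Truncation makes the value legal for coordinate \<open>k\<close>; at each slot it is
  harmless for almost all \<open>k\<close>. Zeros are never affected.\<close>

definition point :: "('s::countable \<Rightarrow> nat) \<Rightarrow> nat \<Rightarrow> nat" where
  "point u k = min (u (slot k)) (Suc k)"

definition overwrite :: "nat list \<Rightarrow> (nat \<Rightarrow> nat) \<Rightarrow> nat \<Rightarrow> nat" where
  "overwrite w x k = (if k < length w then min (w ! k) (Suc k) else x k)"

text \<open>\<open>Suc\<close> reserves 0 for the slots that do not belong to the tuple; the pattern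
  of zeros is what isomorphisms preserve.\<close>

definition tuple_seq :: "'c \<Rightarrow> bool \<Rightarrow> nat list \<Rightarrow> 'c \<times> bool \<times> nat \<Rightarrow> nat" where
  "tuple_seq c b ys = (\<lambda>(c', b', j). if c' = c \<and> b' = b \<and> j < length ys then Suc (ys ! j) else 0)"

text \<open>An element \<open>i\<close> is coded by a constant sequence.  The zeros of the sequence that codes
  \<open>P c zs\<close> reveal \<open>c\<close>, the truth value and the length of \<open>zs\<close>; the dummy entry \<open>z\<close> takes care
  of empty \<open>zs\<close>.\<close>

fun row :: "('c \<Rightarrow> nat list \<Rightarrow> bool) \<Rightarrow> nat + 'c \<times> nat \<times> nat list \<Rightarrow> 'c \<times> bool \<times> nat \<Rightarrow> nat" where
  "row P (Inl i) = (\<lambda>_. Suc i)"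
| "row P (Inr (c, z, zs)) = tuple_seq c (P c zs) (z # zs)"

text \<open>All finite modifications of the rows occur, each of them infinitely often.\<close>

definition coords :: "('c::countable \<Rightarrow> nat list \<Rightarrow> bool) \<Rightarrow> nat \<Rightarrow> nat \<Rightarrow> nat" where
  "coords P n = (case from_nat n of (q, w) \<Rightarrow> overwrite w (point (row P q)))"

lemma coords_to_nat: "coords P (to_nat (q, w)) = overwrite w (point (row P q))"
  by (simp add: coords_def)

lemma overwrite_Nil [simp]: "overwrite [] x = x"
  by (simp add: overwrite_def fun_eq_iff)

lemma coords_le: "coords P n k \<le> Suc k"
  by (simp add: coords_def overwrite_def point_def split: prod.split)

text \<open>A property of almost all coordinates can be inspected at a prescribed slot, and at an
  index \<open>k \<ge> m\<close> where the relevant values are not truncated.\<close>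

lemma slot_frequently:
  assumes "\<forall>\<^sub>F k in sequentially. R k"
  obtains k where "R k" "slot k = s" "m \<le> k"
proof -
  obtain K where K: "\<forall>k\<ge>K. R k"
    using assms unfolding eventually_sequentially by (elim exE)
  define k where "k = prod_encode (to_nat s, max K m)"
  have "max K m \<le> k"
    unfolding k_def by (rule le_prod_encode_2)
  moreover have "slot k = s"
    by (simp add: slot_def k_def)
  ultimately show thesis
    using K by (intro that[of k]) simp_all
qed

lemma eventually_coords:
  fixes P :: "'c::countable \<Rightarrow> nat list \<Rightarrow> bool"
  obtains q where "\<forall>\<^sub>F k in sequentially. coords P n k = point (row P q) k"
proof -
  obtain q :: "nat + 'c \<times> nat \<times> nat list" and w :: "nat list" where qw: "from_nat n = (q, w)"
    by (metis surj_pair)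
  have "\<forall>k\<ge>length w. coords P n k = point (row P q) k"
    by (simp add: coords_def qw overwrite_def)
  then have "\<forall>\<^sub>F k in sequentially. coords P n k = point (row P q) k"
    unfolding eventually_sequentially ..
  then show thesis
    by (rule that)
qed

text \<open>Overwriting the row by any sufficiently long prefix of \<open>x\<close> yields
  \<open>x\<close> itself, so each prefix length gives another name of it.\<close>

lemma infinite_coords_fibre:
  assumes "\<And>k. x k \<le> Suc k" "\<forall>\<^sub>F k in sequentially. x k = point (row P q) k"
  shows "infinite {n. coords P n = x}"
proof -
  obtain K where K: "\<forall>k\<ge>K. x k = point (row P q) k"
    using assms(2) unfolding eventually_sequentially by (elim exE)
  let ?f = "\<lambda>m. to_nat (q, map x [0..<m])"
  have "inj ?f"
  proof (rule injI)
    fix m m' assume "?f m = ?f m'"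
    then have "length (map x [0..<m]) = length (map x [0..<m'])"
      by (metis Pair_inject from_nat_to_nat)
    then show "m = m'"
      by simp
  qed
  then have "inj_on ?f {K..}"
    by (rule inj_on_subset) simp
  then have "infinite (?f ` {K..})"
    by (simp only: finite_image_iff infinite_Ici not_False_eq_True)
  moreover have "?f ` {K..} \<subseteq> {n. coords P n = x}"
  proof
    fix n assume "n \<in> ?f ` {K..}"
    then obtain m where m: "K \<le> m" "n = ?f m"
      by auto
    have "coords P n k = x k" for k
      using K m assms(1)[of k] by (simp add: coords_to_nat overwrite_def min_def)
    then show "n \<in> {n. coords P n = x}"
      by (simp add: fun_eq_iff)
  qed
  ultimately show ?thesis
    by (rule infinite_super[rotated])
qed

lemma rich_coords: "rich UNIV (coords P)"
  unfolding rich_def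
proof (intro conjI ballI allI impI)
  fix K :: nat and v :: "nat \<Rightarrow> nat"
  assume v: "\<forall>k. v k \<le> Suc k"
  define n where "n = to_nat (Inl 0 :: nat + 'a \<times> nat \<times> nat list, map v [0..<K])"
  have "coords P n k = v k" if "k < K" for k
    using v[rule_format, of k] that by (simp add: n_def coords_to_nat overwrite_def)
  then show "\<exists>n\<in>UNIV. \<forall>k<K. coords P n k = v k"
    by (intro bexI[of _ n]) simp_all
qed (rule coords_le)

text \<open>Corresponding fibres are countably infinite and are matched by their enumerations. This
  reduces the construction of an isomorphism to the equality of two sets of sequences.\<close>

lemma ex_bij_fibrewise:
  fixes D D' :: "nat \<Rightarrow> 'x"
  assumes "range D = range D'" "\<And>n. infinite {m. D m = D n}" "\<And>n. infinite {m. D' m = D' n}"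
  obtains h where "bij h" "\<And>n. D' (h n) = D n"
proof -
  have "\<exists>f. bij_betw f {m. D m = D n} {m. D' m = D n}" for n
  proof -
    obtain n' where "D n = D' n'"
      using assms(1) by (metis rangeE rangeI)
    then have inf: "infinite {m. D m = D n}" "infinite {m. D' m = D n}"
      using assms(2)[of n] assms(3)[of n'] by simp_all
    show ?thesis
      using bij_betw_trans[OF bij_betw_inv_into[OF bij_enumerate[OF inf(1)]] bij_enumerate[OF inf(2)]]
      by blast
  qed
  then have "\<forall>y. \<exists>f. y \<in> range D \<longrightarrow> bij_betw f {m. D m = y} {m. D' m = y}"
    by blast
  from choice[OF this] obtain f where
    f: "\<forall>y. y \<in> range D \<longrightarrow> bij_betw (f y) {m. D m = y} {m. D' m = y}" ..
  define h where "h n = f (D n) n" for n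
  have fb: "bij_betw (f (D n)) {m. D m = D n} {m. D' m = D n}" for n
    using f by simp
  have h: "D' (h n) = D n" for n
    using bij_betw_apply[OF fb[of n], of n] by (simp add: h_def)
  have "bij h"
  proof (rule bijI)
    show "inj h"
    proof (rule injI)
      fix n m assume eq: "h n = h m"
      then have D: "D n = D m"
        using h by metis
      then have "f (D n) n = f (D n) m"
        using eq by (simp add: h_def)
      then show "n = m"
        using inj_onD[OF bij_betw_imp_inj_on[OF fb[of n]], of n m] D by simp
    qed
    show "surj h"
    proof (unfold surj_def, rule allI)
      fix m
      obtain n where n: "D' m = D n"
        using assms(1) by (metis rangeE rangeI)
      then have "m \<in> f (D n) ` {k. D k = D n}"
        using bij_betw_imp_surj_on[OF fb[of n]] by simp
      then obtain k where "D k = D n" "m = f (D n) k"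
        by auto
      then have "m = h k"
        by (simp add: h_def)
      then show "\<exists>k. m = h k" ..
    qed
  qed
  then show thesis
    using h by (rule that)
qed

text \<open>The part of \<open>\<tau>\<close> that stays inside \<open>A\<close> is a bijection
  between subsets of equal finite size; their complements in \<open>A\<close> then have equal size
  as well and can be matched arbitrarily.\<close>

lemma extend_to_permutation:
  fixes \<tau> :: "'a \<Rightarrow> 'a"
  assumes "finite A" "inj \<tau>"
  shows "\<exists>g. bij_betw g A A \<and> (\<forall>i\<in>A. \<tau> i \<in> A \<longrightarrow> g i = \<tau> i)"
proof -
  define I where "I = {i \<in> A. \<tau> i \<in> A}"
  have I: "I \<subseteq> A" "\<tau> ` I \<subseteq> A" "inj_on \<tau> I"
    using assms(2) by (auto simp: I_def intro: inj_on_subset)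
  then have "card (A - I) = card (A - \<tau> ` I)"
    using assms(1) by (simp add: card_Diff_subset finite_subset card_image)
  then obtain f where f: "bij_betw f (A - I) (A - \<tau> ` I)"
    using finite_same_card_bij[of "A - I" "A - \<tau> ` I"] assms(1) by auto
  define g where "g i = (if i \<in> I then \<tau> i else f i)" for i
  have "bij_betw g I (\<tau> ` I)"
    using I(3) by (simp add: g_def inj_on_imp_bij_betw cong: bij_betw_cong)
  moreover have "bij_betw g (A - I) (A - \<tau> ` I)"
    using f by (rule bij_betw_cong[THEN iffD1, rotated]) (simp add: g_def)
  ultimately have "bij_betw g (I \<union> (A - I)) (\<tau> ` I \<union> (A - \<tau> ` I))"
    by (rule bij_betw_combine) auto
  moreover have "I \<union> (A - I) = A" "\<tau> ` I \<union> (A - \<tau> ` I) = A"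
    using I by blast+
  ultimately show ?thesis
    by (intro exI[of _ g]) (simp add: g_def I_def)
qed

text \<open>Boundedness gives one index beyond which truncation affects the row at no slot.\<close>

lemma finite_range_row: "finite (range (row P q))"
proof (cases q)
  case (Inr t)
  obtain c z zs where t: "t = (c, z, zs)"
    by (metis prod_cases3)
  have "range (row P q) \<subseteq> insert 0 (Suc ` set (z # zs))"
  proof (rule image_subsetI)
    fix s :: "'a \<times> bool \<times> nat"
    obtain c' b' j where s: "s = (c', b', j)"
      by (metis prod_cases3)
    have "Suc ((z # zs) ! j) \<in> Suc ` set (z # zs)" if "j < length (z # zs)"
      using that by (intro imageI nth_mem)
    then show "row P q s \<in> insert 0 (Suc ` set (z # zs))"
      unfolding Inr t s row.simps tuple_seq_def by (simp only: prod.case) simp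
  qed
  then show ?thesis
    by (rule finite_subset) simp
qed simp

section \<open>Isomorphisms between codes\<close>

lemma tuples_2: "(\<forall>xs\<in>tuples UNIV 2. R xs) \<longleftrightarrow> (\<forall>x y. R [x, y])"
  by (auto simp: tuples_def numeral_2_eq_2 length_Suc_conv)

lemma isomorphic_coord_structure_iff:
  "isomorphic coord_language (coord_structure UNIV d) (coord_structure UNIV d') \<longleftrightarrow>
    (\<exists>h. bij h \<and> (\<forall>k n m. d n k = d m k \<and> d n k \<noteq> 0 \<longleftrightarrow>
       d' (h n) k = d' (h m) k \<and> d' (h n) k \<noteq> 0))"
proof -
  have "(\<forall>xs\<in>tuples UNIV 2. xs \<in> rel_int (coord_structure UNIV d) k \<longleftrightarrow>
      map h xs \<in> rel_int (coord_structure UNIV d') k) \<longleftrightarrow>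
    (\<forall>n m. d n k = d m k \<and> d n k \<noteq> 0 \<longleftrightarrow> d' (h n) k = d' (h m) k \<and> d' (h n) k \<noteq> 0)" for h k
    by (simp only: tuples_2 list.map coord_structure_simps)
  moreover have "funs coord_language = {}" "rels coord_language = UNIV" "\<And>k. rel_arity coord_language k = 2"
    by (simp_all add: coord_language_def)
  ultimately show ?thesis
    unfolding isomorphic_def by simp
qed

text \<open>On the \<open>k\<close>-th coordinate a permutation of the elements acts through a permutation of
  \<open>{0, \<dots>, k + 1}\<close> that fixes 0 and agrees with it as far as possible.  This maps rows to rows up
  to finite modifications.\<close>

lemma coords_isomorphic:
  fixes P Q :: "'c::countable \<Rightarrow> nat list \<Rightarrow> bool"
  assumes \<sigma>: "bij \<sigma>" and PQ: "\<And>c zs. P c zs \<longleftrightarrow> Q c (map \<sigma> zs)"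
  shows "isomorphic coord_language (coord_structure UNIV (coords P)) (coord_structure UNIV (coords Q))"
proof -
  \<comment> \<open>An element \<open>i\<close> is stored as \<open>Suc i\<close>, so
    \<open>\<sigma>\<close> is shifted by one and 0 stays fixed.\<close>
  define \<tau> where "\<tau> i = (case i of 0 \<Rightarrow> 0 | Suc j \<Rightarrow> Suc (\<sigma> j))" for i
  have \<tau>_simps [simp]: "\<tau> 0 = 0" "\<tau> (Suc j) = Suc (\<sigma> j)" for j
    by (simp_all add: \<tau>_def)
  have "inj \<tau>"
  proof (rule injI)
    fix i j assume "\<tau> i = \<tau> j"
    then show "i = j"
      using injD[OF bij_is_inj[OF \<sigma>]] by (cases i; cases j) simp_all
  qed
  have "\<forall>k. \<exists>g. bij_betw g {..Suc k} {..Suc k} \<and> (\<forall>i. i \<le> Suc k \<longrightarrow> \<tau> i \<le> Suc k \<longrightarrow> g i = \<tau> i)"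
  proof
    fix k
    show "\<exists>g. bij_betw g {..Suc k} {..Suc k} \<and> (\<forall>i. i \<le> Suc k \<longrightarrow> \<tau> i \<le> Suc k \<longrightarrow> g i = \<tau> i)"
      using extend_to_permutation[OF finite_atMost[of "Suc k"] \<open>inj \<tau>\<close>]
      by (simp only: Ball_def atMost_iff)
  qed
  from choice[OF this] obtain g where
    "\<forall>k. bij_betw (g k) {..Suc k} {..Suc k} \<and> (\<forall>i. i \<le> Suc k \<longrightarrow> \<tau> i \<le> Suc k \<longrightarrow> g k i = \<tau> i)" ..
  then have g: "\<And>k. bij_betw (g k) {..Suc k} {..Suc k}"
      "\<And>k i. i \<le> Suc k \<Longrightarrow> \<tau> i \<le> Suc k \<Longrightarrow> g k i = \<tau> i"
    by simp_all
  have g0: "g k 0 = 0" for k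
    using g(2)[of 0 k] by simp
  have g_inj: "g k i = g k j \<longleftrightarrow> i = j" if "i \<le> Suc k" "j \<le> Suc k" for i j k
    using inj_on_eq_iff[OF bij_betw_imp_inj_on[OF g(1)[of k]]] that by simp
  have g_le: "g k i \<le> Suc k" if "i \<le> Suc k" for i k
    using bij_betw_apply[OF g(1)[of k], of i] that by simp
  \<comment> \<open>The dummy entry is renamed too, since it is an entry of the coded sequence like
    the others.\<close>
  define rename where "rename = map_sum \<sigma> (\<lambda>(c :: 'c, z, zs). (c, \<sigma> z, map \<sigma> zs))"
  have row_rename: "row Q (rename q) s = \<tau> (row P q s)" for q s
  proof (cases q)
    case (Inr t)
    obtain c z zs where t: "t = (c, z, zs)"
      by (metis prod_cases3)
    obtain c' b' j where s: "s = (c', b', j)"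
      by (metis prod_cases3)
    have "(\<sigma> z # map \<sigma> zs) ! j = \<sigma> ((z # zs) ! j)" if "j < Suc (length zs)"
      using that nth_map[of j "z # zs" \<sigma>] by simp
    then show ?thesis
      using PQ[of c zs] by (simp add: Inr t s rename_def tuple_seq_def)
  qed (simp add: rename_def)
  have "surj rename"
  proof (unfold surj_def, rule allI)
    fix q'
    show "\<exists>q. q' = rename q"
    proof (cases q')
      case (Inl i)
      then show ?thesis
        using surjD[OF bij_is_surj[OF \<sigma>], of i] by (auto simp: rename_def intro: exI[of _ "Inl _"])
    next
      case (Inr t)
      obtain c z zs where t: "t = (c, z, zs)"
        by (metis prod_cases3)
      have "q' = rename (Inr (c, inv \<sigma> z, map (inv \<sigma>) zs))"
        using bij_is_surj[OF \<sigma>] by (simp add: rename_def Inr t surj_f_inv_f o_def)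
      then show ?thesis ..
    qed
  qed
  have g_point: "\<forall>\<^sub>F k in sequentially. g k (point (row P q) k) = point (row Q (rename q)) k" for q
  proof -
    \<comment> \<open>Beyond a common bound neither the row nor its image under
      \<open>\<tau>\<close> is truncated, and \<open>g k\<close> agrees with \<open>\<tau>\<close>
      on the values of the row.\<close>
    have "finite (range (row P q) \<union> \<tau> ` range (row P q))"
      using finite_range_row by blast
    then obtain B where B: "\<And>i. i \<in> range (row P q) \<union> \<tau> ` range (row P q) \<Longrightarrow> i \<le> B"
      unfolding finite_nat_set_iff_bounded_le by blast
    have "g k (point (row P q) k) = point (row Q (rename q)) k" if "B \<le> k" for k
    proof -
      have "row P q (slot k) \<le> Suc k" "\<tau> (row P q (slot k)) \<le> Suc k"
        using B[of "row P q (slot k)"] B[of "\<tau> (row P q (slot k))"] that by auto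
      then show ?thesis
        using g(2) by (simp add: point_def row_rename min_def)
    qed
    then show ?thesis
      unfolding eventually_sequentially by (intro exI[of _ B] allI impI)
  qed
  \<comment> \<open>The points of the first code with the permutations applied. It remains to see
    that they form the same set of sequences as the second code.\<close>
  define D where "D n k = g k (coords P n k)" for n k
  have D_le: "D n k \<le> Suc k" for n k
    unfolding D_def by (rule g_le[OF coords_le])
  have D_ev: "\<exists>q. \<forall>\<^sub>F k in sequentially. D n k = point (row Q q) k" for n
  proof -
    obtain q where "\<forall>\<^sub>F k in sequentially. coords P n k = point (row P q) k"
      using eventually_coords .
    with g_point[of q] have "\<forall>\<^sub>F k in sequentially. D n k = point (row Q (rename q)) k"
      by eventually_elim (simp add: D_def)
    then show ?thesis ..
  qed
  have "range D = range (coords Q)"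
  proof
    show "range D \<subseteq> range (coords Q)"
    proof (rule image_subsetI)
      fix n
      obtain q where "\<forall>\<^sub>F k in sequentially. D n k = point (row Q q) k"
        using D_ev by blast
      then have "infinite {m. coords Q m = D n}"
        by (rule infinite_coords_fibre[OF D_le])
      then have "{m. coords Q m = D n} \<noteq> {}"
        by (metis finite.emptyI)
      then show "D n \<in> range (coords Q)"
        by (metis (mono_tags) empty_Collect_eq rangeI)
    qed
    show "range (coords Q) \<subseteq> range D"
    proof (rule image_subsetI)
      fix m
      obtain q' where q': "\<forall>\<^sub>F k in sequentially. coords Q m k = point (row Q q') k"
        using eventually_coords .
      obtain q where q: "q' = rename q"
        using surjD[OF \<open>surj rename\<close>] by blast
      \<comment> \<open>The preimage under the permutations; it is again a finite modification of a
        row, hence is coded.\<close>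
      define x where "x k = inv_into {..Suc k} (g k) (coords Q m k)" for k
      have mem: "coords Q m k \<in> g k ` {..Suc k}" for k
        using bij_betw_imp_surj_on[OF g(1)[of k]] coords_le[of Q m k] by simp
      have x_le: "x k \<le> Suc k" for k
        using inv_into_into[OF mem[of k]] by (simp add: x_def)
      have gx: "g k (x k) = coords Q m k" for k
        unfolding x_def by (rule f_inv_into_f[OF mem])
      from q' g_point[of q] have "\<forall>\<^sub>F k in sequentially. x k = point (row P q) k"
      proof eventually_elim
        case (elim k)
        then have "g k (x k) = g k (point (row P q) k)"
          by (simp add: gx q)
        then show ?case
          using g_inj[OF x_le] by (simp add: point_def)
      qed
      then have "infinite {n. coords P n = x}"
        by (rule infinite_coords_fibre[OF x_le])
      then have "{n. coords P n = x} \<noteq> {}"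
        by (metis finite.emptyI)
      then obtain n where "coords P n = x"
        by blast
      then have "D n = coords Q m"
        by (simp add: D_def fun_eq_iff gx)
      then show "coords Q m \<in> range D"
        by (metis rangeI)
    qed
  qed
  moreover have "infinite {m. D m = D n}" for n
  proof -
    obtain q where "\<forall>\<^sub>F k in sequentially. coords P n k = point (row P q) k"
      using eventually_coords .
    then have "infinite {m. coords P m = coords P n}"
      by (rule infinite_coords_fibre[OF coords_le])
    moreover have "{m. coords P m = coords P n} \<subseteq> {m. D m = D n}"
      by (auto simp: D_def fun_eq_iff)
    ultimately show ?thesis
      by (rule infinite_super[rotated])
  qed
  moreover have "infinite {m. coords Q m = coords Q n}" for n
  proof -
    obtain q where "\<forall>\<^sub>F k in sequentially. coords Q n k = point (row Q q) k"
      using eventually_coords .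
    then show ?thesis
      by (rule infinite_coords_fibre[OF coords_le])
  qed
  ultimately obtain h where h: "bij h" "\<And>n. coords Q (h n) = D n"
    using ex_bij_fibrewise by metis
  have "coords P n k = coords P m k \<and> coords P n k \<noteq> 0 \<longleftrightarrow>
      coords Q (h n) k = coords Q (h m) k \<and> coords Q (h n) k \<noteq> 0" for k n m
  proof -
    \<comment> \<open>Applying \<open>g k\<close> changes neither agreement, as it is injective on
      legal values, nor vanishing, as it fixes 0.\<close>
    have "D n k = D m k \<longleftrightarrow> coords P n k = coords P m k" "D n k = 0 \<longleftrightarrow> coords P n k = 0"
      using g_inj[OF coords_le coords_le] g_inj[OF coords_le, of 0 k P n] by (simp_all add: D_def g0)
    then show ?thesis
      by (simp add: h(2))
  qed
  with h(1) show ?thesis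
    unfolding isomorphic_coord_structure_iff by blast
qed

text \<open>The row of a tuple vanishes at every slot with the opposite truth value, hence at
  infinitely many coordinates. So eventual nonvanishing, which isomorphisms preserve, singles out
  the points of elements.\<close>

lemma eventually_coords_vertex_iff:
  fixes P :: "'c::countable \<Rightarrow> nat list \<Rightarrow> bool"
  shows "(\<forall>\<^sub>F k in sequentially. coords P n k \<noteq> 0) \<longleftrightarrow>
    (\<exists>i. \<forall>\<^sub>F k in sequentially. coords P n k = point (\<lambda>_ :: 'c \<times> bool \<times> nat. Suc i) k)"
proof
  assume nz: "\<forall>\<^sub>F k in sequentially. coords P n k \<noteq> 0"
  obtain q where q: "\<forall>\<^sub>F k in sequentially. coords P n k = point (row P q) k"
    by (rule eventually_coords)
  show "\<exists>i. \<forall>\<^sub>F k in sequentially. coords P n k = point (\<lambda>_ :: 'c \<times> bool \<times> nat. Suc i) k"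
  proof (cases q)
    case (Inl i)
    then show ?thesis
      using q by (intro exI[of _ i]) simp
  next
    case (Inr t)
    obtain c z zs where t: "t = (c, z, zs)"
      by (metis prod_cases3)
    from nz q have "\<forall>\<^sub>F k in sequentially. point (row P q) k \<noteq> 0"
      by eventually_elim simp
    then obtain k where "point (row P q) k \<noteq> 0" "slot k = (c, \<not> P c zs, 0 :: nat)"
      by (rule slot_frequently)
    then show ?thesis
      by (simp add: point_def Inr t tuple_seq_def)
  qed
next
  assume "\<exists>i. \<forall>\<^sub>F k in sequentially. coords P n k = point (\<lambda>_ :: 'c \<times> bool \<times> nat. Suc i) k"
  then obtain i where
    "\<forall>\<^sub>F k in sequentially. coords P n k = point (\<lambda>_ :: 'c \<times> bool \<times> nat. Suc i) k" ..
  then show "\<forall>\<^sub>F k in sequentially. coords P n k \<noteq> 0"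
    by eventually_elim (simp add: point_def)
qed

lemma eventually_point_const_iff:
  "(\<forall>\<^sub>F k in sequentially. point (\<lambda>_ :: 's::countable. Suc i) k = point (\<lambda>_ :: 's. Suc j) k) \<longleftrightarrow> i = j"
proof
  assume "\<forall>\<^sub>F k in sequentially. point (\<lambda>_ :: 's. Suc i) k = point (\<lambda>_ :: 's. Suc j) k"
  then obtain k where "point (\<lambda>_ :: 's. Suc i) k = point (\<lambda>_ :: 's. Suc j) k" "max i j \<le> k"
    by (rule slot_frequently)
  then show "i = j"
    by (simp add: point_def)
qed simp

text \<open>Conversely, an isomorphism permutes the elements whose coordinates are eventually nonzero, up
  to finite modifications; this is the desired permutation of \<open>\<omega>\<close>.\<close>

lemma isomorphic_coords:
  fixes P Q :: "'c::countable \<Rightarrow> nat list \<Rightarrow> bool"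
  assumes "isomorphic coord_language (coord_structure UNIV (coords P)) (coord_structure UNIV (coords Q))"
  obtains \<sigma> where "bij \<sigma>" "\<And>c zs. P c zs \<longleftrightarrow> Q c (map \<sigma> zs)"
proof -
  obtain h where "bij h" and h: "\<And>k n m. coords P n k = coords P m k \<and> coords P n k \<noteq> 0 \<longleftrightarrow>
       coords Q (h n) k = coords Q (h m) k \<and> coords Q (h n) k \<noteq> 0"
    using assms unfolding isomorphic_coord_structure_iff by metis
  define E where "E i = point (\<lambda>_ :: 'c \<times> bool \<times> nat. Suc i)" for i
  define vert where "vert i = to_nat (Inl i :: nat + 'c \<times> nat \<times> nat list, [] :: nat list)" for i
  have E_nz: "E i k \<noteq> 0" for i k
    by (simp add: E_def point_def)
  have E_eq: "(\<forall>\<^sub>F k in sequentially. E i k = E j k) \<longleftrightarrow> i = j" for i j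
    unfolding E_def by (rule eventually_point_const_iff)
  have vert: "coords P (vert i) = E i" "coords Q (vert i) = E i" for i
    by (simp_all add: vert_def coords_to_nat E_def)
  \<comment> \<open>Relating a point to itself detects the value 0.\<close>
  have zero: "coords P n k = 0 \<longleftrightarrow> coords Q (h n) k = 0" for n k
    using h[of n k n] by metis
  have is_vert: "(\<forall>\<^sub>F k in sequentially. coords R n k \<noteq> 0) \<longleftrightarrow>
      (\<exists>i. \<forall>\<^sub>F k in sequentially. coords R n k = E i k)" for R :: "'c \<Rightarrow> nat list \<Rightarrow> bool" and n
    unfolding E_def by (rule eventually_coords_vertex_iff)
  have "\<exists>j. \<forall>\<^sub>F k in sequentially. coords Q (h (vert i)) k = E j k" for i
  proof -
    have "\<forall>\<^sub>F k in sequentially. coords Q (h (vert i)) k \<noteq> 0"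
      using E_nz by (simp add: vert flip: zero)
    then show ?thesis
      unfolding is_vert .
  qed
  then have "\<forall>i. \<exists>j. \<forall>\<^sub>F k in sequentially. coords Q (h (vert i)) k = E j k" ..
  from choice[OF this] obtain \<sigma> where
    \<sigma>: "\<forall>i. \<forall>\<^sub>F k in sequentially. coords Q (h (vert i)) k = E (\<sigma> i) k" ..
  have "bij \<sigma>"
  proof (rule bijI)
    show "inj \<sigma>"
    proof (rule injI)
      fix i j assume eq: "\<sigma> i = \<sigma> j"
      \<comment> \<open>Both images agree with the same constant sequence at almost all
        \<open>k\<close>; they are related there, and so are the points of \<open>i\<close> and
        \<open>j\<close>.\<close>
      from \<sigma>[rule_format, of i] \<sigma>[rule_format, of j]
      have "\<forall>\<^sub>F k in sequentially. E i k = E j k"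
      proof eventually_elim
        case (elim k)
        then show ?case
          using h[of "vert i" k "vert j"] E_nz eq by (simp add: vert)
      qed
      then show "i = j"
        by (simp only: E_eq)
    qed
    show "surj \<sigma>"
    proof (unfold surj_def, rule allI)
      fix j
      obtain n where n: "vert j = h n"
        using bij_is_surj[OF \<open>bij h\<close>] by (metis surjD)
      have "\<forall>\<^sub>F k in sequentially. coords P n k \<noteq> 0"
        using E_nz by (simp add: zero vert flip: n)
      then obtain i where i: "\<forall>\<^sub>F k in sequentially. coords P n k = E i k"
        unfolding is_vert ..
      from i \<sigma>[rule_format, of i] have "\<forall>\<^sub>F k in sequentially. E j k = E (\<sigma> i) k"
      proof eventually_elim
        case (elim k)
        then show ?case
          using h[of n k "vert i"] E_nz by (simp add: vert flip: n)
      qed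
      then have "j = \<sigma> i"
        by (simp only: E_eq)
      then show "\<exists>i. j = \<sigma> i" ..
    qed
  qed
  moreover have "P c zs \<longleftrightarrow> Q c (map \<sigma> zs)" for c zs
  proof -
    define ys where "ys = (0 :: nat) # zs"
    define u where "u = tuple_seq c (P c zs) ys"
    define n where "n = to_nat (Inr (c, 0, zs) :: nat + 'c \<times> nat \<times> nat list, [] :: nat list)"
    have n: "coords P n = point u"
      by (simp add: n_def coords_to_nat u_def ys_def)
    obtain q where q: "\<forall>\<^sub>F k in sequentially. coords Q (h n) k = point (row Q q) k"
      by (rule eventually_coords)
    \<comment> \<open>Each slot is met at a coordinate where the image has its row value, and
      truncation neither creates nor removes zeros.\<close>
    have zeros: "u s = 0 \<longleftrightarrow> row Q q s = 0" for s
    proof -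
      obtain k where k: "coords Q (h n) k = point (row Q q) k" "slot k = s"
        using q by (rule slot_frequently)
      then show ?thesis
        using zero[of n k] by (simp add: n point_def min_def split: if_splits)
    qed
    obtain c' z' zs' where q': "q = Inr (c', z', zs')"
    proof (cases q)
      case (Inl i)
      then show thesis
        using zeros[of "(c, \<not> P c zs, 0)"] by (simp add: u_def tuple_seq_def)
    next
      case (Inr t)
      then show thesis
        using that by (metis prod_cases3)
    qed
    define ys' where "ys' = z' # zs'"
    have rowq: "row Q q = tuple_seq c' (Q c' zs') ys'"
      by (simp add: q' ys'_def)
    \<comment> \<open>Thanks to the dummy entry, position 0 is nonzero in the one block that carries
      the right symbol and truth value.\<close>
    have c: "c' = c" "Q c' zs' = P c zs"
      using zeros[of "(c, P c zs, 0)"]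
      by (simp_all add: u_def rowq tuple_seq_def ys_def split: if_splits)
    have len: "j < length ys \<longleftrightarrow> j < length ys'" for j
      using zeros[of "(c, P c zs, j)"] c by (simp add: u_def rowq tuple_seq_def split: if_splits)
    have "ys' = map \<sigma> ys"
    proof (rule nth_equalityI)
      show "length ys' = length (map \<sigma> ys)"
        using len[of "length ys"] len[of "length ys'"] by simp
      fix j assume j: "j < length ys'"
      then have j': "j < length ys"
        by (simp only: len)
      from q \<sigma>[rule_format, of "ys ! j"]
      have "\<forall>\<^sub>F k in sequentially. coords Q (h n) k = point (row Q q) k \<and>
          coords Q (h (vert (ys ! j))) k = E (\<sigma> (ys ! j)) k"
        by (rule eventually_conj)
      then obtain k where k: "coords Q (h n) k = point (row Q q) k"
          "coords Q (h (vert (ys ! j))) k = E (\<sigma> (ys ! j)) k"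
          "slot k = (c, P c zs, j)" "max (ys' ! j) (\<sigma> (ys ! j)) \<le> k"
        by (rule slot_frequently) blast
      \<comment> \<open>At this slot the tuple has the same value as the point of its
        \<open>j\<close>-th entry. The isomorphism preserves this agreement, which identifies the
        corresponding entry of the image.\<close>
      have "coords P n k = coords P (vert (ys ! j)) k \<and> coords P n k \<noteq> 0"
        using j' by (simp add: n vert E_def point_def k(3) u_def tuple_seq_def)
      then have "coords Q (h n) k = coords Q (h (vert (ys ! j))) k"
        using h by blast
      then have "min (Suc (ys' ! j)) (Suc k) = min (Suc (\<sigma> (ys ! j))) (Suc k)"
        unfolding k(1,2) using j c by (simp add: E_def point_def k(3) rowq tuple_seq_def)
      then show "ys' ! j = map \<sigma> ys ! j"
        using k(4) j' by simp
    qed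
    then have "zs' = map \<sigma> zs"
      by (simp add: ys_def ys'_def)
    then show ?thesis
      using c by simp
  qed
  ultimately show thesis
    by (rule that)
qed

section \<open>Borel completeness\<close>

text \<open>Functions enter through their graphs, with the value at the head. Everything outside the
  language is false, so the coding need not know the arities.\<close>

definition atoms ::
    "('f, 'r) fo_language \<Rightarrow> ('f, 'r, 'a) fo_structure \<Rightarrow> 'f + 'r \<Rightarrow> 'a list \<Rightarrow> bool" where
  "atoms L N s zs = (case s of
     Inl f \<Rightarrow> f \<in> funs L \<and> length zs = Suc (fun_arity L f) \<and> fun_int N f (tl zs) = hd zs
   | Inr R \<Rightarrow> R \<in> rels L \<and> length zs = rel_arity L R \<and> zs \<in> rel_int N R)"

lemma isomorphic_iff_atoms:
  fixes M :: "('f, 'r, 'a) fo_structure" and N :: "('f, 'r, 'b) fo_structure"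
  assumes "univ M = UNIV" "univ N = UNIV"
  shows "isomorphic L M N \<longleftrightarrow> (\<exists>\<sigma>. bij \<sigma> \<and> (\<forall>s zs. atoms L M s zs \<longleftrightarrow> atoms L N s (map \<sigma> zs)))"
proof -
  have "(\<forall>f\<in>funs L. \<forall>xs\<in>tuples UNIV (fun_arity L f). h (fun_int M f xs) = fun_int N f (map h xs)) \<and>
     (\<forall>R\<in>rels L. \<forall>xs\<in>tuples UNIV (rel_arity L R). xs \<in> rel_int M R \<longleftrightarrow> map h xs \<in> rel_int N R)
     \<longleftrightarrow> (\<forall>s zs. atoms L M s zs \<longleftrightarrow> atoms L N s (map h zs))" (is "?F \<and> ?R \<longleftrightarrow> ?A")
    if "bij h" for h
  proof
    assume FR: "?F \<and> ?R"
    show ?A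
    proof (intro allI)
      fix s zs
      show "atoms L M s zs \<longleftrightarrow> atoms L N s (map h zs)"
      proof (cases s)
        case (Inr R)
        then show ?thesis
          using FR by (auto simp: atoms_def tuples_def)
      next
        case (Inl f)
        show ?thesis
        proof (cases "f \<in> funs L \<and> length zs = Suc (fun_arity L f)")
          case True
          then obtain y xs where zs: "zs = y # xs" "length xs = fun_arity L f"
            by (metis length_Suc_conv)
          have "h (fun_int M f xs) = fun_int N f (map h xs)"
            using FR True zs by (simp add: tuples_def)
          moreover have "h (fun_int M f xs) = h y \<longleftrightarrow> fun_int M f xs = y"
            using bij_is_inj[OF that] by (rule inj_eq)
          ultimately show ?thesis
            using True by (simp add: atoms_def Inl zs)
        qed (auto simp: atoms_def Inl)
      qed
    qed
  next
    assume A: ?A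
    show "?F \<and> ?R"
    proof (intro conjI ballI)
      fix f and xs :: "'a list"
      assume "f \<in> funs L" "xs \<in> tuples UNIV (fun_arity L f)"
      \<comment> \<open>The graph atom with the correct value at the head is true in
        \<open>M\<close>, and its image in \<open>N\<close> is the claim.\<close>
      then show "h (fun_int M f xs) = fun_int N f (map h xs)"
        using A[rule_format, of "Inl f" "fun_int M f xs # xs"] by (simp add: atoms_def tuples_def)
    next
      fix R and xs :: "'a list"
      assume "R \<in> rels L" "xs \<in> tuples UNIV (rel_arity L R)"
      then show "xs \<in> rel_int M R \<longleftrightarrow> map h xs \<in> rel_int N R"
        using A[rule_format, of "Inr R" xs] by (simp add: atoms_def tuples_def)
    qed
  qed
  then show ?thesis
    unfolding isomorphic_def assms by (intro ex_cong) simp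
qed

section \<open>Borel measurability of the coding map\<close>

lemma openin_omega_subbasis:
  "openin (omega_topology L) (omega_structures L)"
  "f \<in> funs L \<Longrightarrow> length xs = fun_arity L f \<Longrightarrow>
    openin (omega_topology L) {N \<in> omega_structures L. fun_int N f xs = y}"
  "R \<in> rels L \<Longrightarrow> length xs = rel_arity L R \<Longrightarrow>
    openin (omega_topology L) {N \<in> omega_structures L. xs \<in> rel_int N R}"
  "R \<in> rels L \<Longrightarrow> length xs = rel_arity L R \<Longrightarrow>
    openin (omega_topology L) {N \<in> omega_structures L. xs \<notin> rel_int N R}"
proof -
  show "openin (omega_topology L) (omega_structures L)"
    unfolding omega_topology_def by (intro topology_generated_by_Basis UnI1 singletonI)
  show "openin (omega_topology L) {N \<in> omega_structures L. fun_int N f xs = y}"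
    if "f \<in> funs L" "length xs = fun_arity L f"
    unfolding omega_topology_def
    by (rule topology_generated_by_Basis, rule UnI1, rule UnI1, rule UnI2, rule CollectI)
      (intro exI[of _ f] exI[of _ xs] exI[of _ y] conjI refl that)
  show "openin (omega_topology L) {N \<in> omega_structures L. xs \<in> rel_int N R}"
    if "R \<in> rels L" "length xs = rel_arity L R"
    unfolding omega_topology_def
    by (rule topology_generated_by_Basis, rule UnI1, rule UnI2, rule CollectI)
      (intro exI[of _ R] exI[of _ xs] conjI refl that)
  show "openin (omega_topology L) {N \<in> omega_structures L. xs \<notin> rel_int N R}"
    if "R \<in> rels L" "length xs = rel_arity L R"
    unfolding omega_topology_def
    by (rule topology_generated_by_Basis, rule UnI2, rule CollectI)
      (intro exI[of _ R] exI[of _ xs] conjI refl that)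
qed

text \<open>With both truth values covered, atoms are clopen: a function takes some value, so the
  failure of a graph atom is the union of the open conditions for all other values.\<close>

lemma openin_atoms: "openin (omega_topology L) {N \<in> omega_structures L. atoms L N s zs = b}"
proof (cases s)
  case (Inl f)
  show ?thesis
  proof (cases "f \<in> funs L \<and> length zs = Suc (fun_arity L f)")
    case True
    have op: "openin (omega_topology L) {N \<in> omega_structures L. fun_int N f (tl zs) = y}" for y
      using True by (intro openin_omega_subbasis(2)) simp_all
    have "{N \<in> omega_structures L. atoms L N s zs = b} =
        (\<Union>y\<in>{y. (y = hd zs) = b}. {N \<in> omega_structures L. fun_int N f (tl zs) = y})"
      using True by (auto simp: atoms_def Inl)
    then show ?thesis
      using op by auto
  next
    case False
    then have "{N \<in> omega_structures L. atoms L N s zs = b} = (if b then {} else omega_structures L)"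
      by (auto simp: atoms_def Inl)
    then show ?thesis
      by (simp add: openin_omega_subbasis(1))
  qed
next
  case (Inr R)
  show ?thesis
  proof (cases "R \<in> rels L \<and> length zs = rel_arity L R")
    case True
    have "{N \<in> omega_structures L. atoms L N s zs = b} =
        (if b then {N \<in> omega_structures L. zs \<in> rel_int N R} else {N \<in> omega_structures L. zs \<notin> rel_int N R})"
      using True by (auto simp: atoms_def Inr)
    moreover have "openin (omega_topology L) {N \<in> omega_structures L. zs \<in> rel_int N R}"
      using True by (intro openin_omega_subbasis(3)) simp_all
    moreover have "openin (omega_topology L) {N \<in> omega_structures L. zs \<notin> rel_int N R}"
      using True by (intro openin_omega_subbasis(4)) simp_all
    ultimately show ?thesis
      by simp
  next
    case False
    then have "{N \<in> omega_structures L. atoms L N s zs = b} = (if b then {} else omega_structures L)"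
      by (auto simp: atoms_def Inr)
    then show ?thesis
      by (simp add: openin_omega_subbasis(1))
  qed
qed

definition coord_code :: "(nat, nat) fo_language \<Rightarrow> (nat, nat, nat) fo_structure \<Rightarrow> (nat, nat, nat) fo_structure" where
  "coord_code L N = coord_structure UNIV (coords (atoms L N))"

lemma coord_code_in_omega_structures: "coord_code L N \<in> omega_structures coord_language"
  by (auto simp: coord_code_def coord_structure_def omega_structures_def coord_language_def)

text \<open>The name \<open>n\<close> fixes the row and the modification. Only the row of a tuple
  consults \<open>P\<close>, and only at that tuple.\<close>

lemma coords_depends_on_atom:
  "\<exists>(c :: 'c::countable) zs. \<forall>P Q. P c zs = Q c zs \<longrightarrow> coords P n = coords Q n"
proof -
  obtain q :: "nat + 'c \<times> nat \<times> nat list" and w :: "nat list" where qw: "from_nat n = (q, w)"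
    by (metis surj_pair)
  show ?thesis
  proof (cases q)
    case (Inl i)
    then show ?thesis
      by (simp add: coords_def qw)
  next
    case (Inr t)
    obtain c z zs where t: "t = (c, z, zs)"
      by (metis prod_cases3)
    show ?thesis
      by (intro exI[of _ c] exI[of _ zs]) (simp add: coords_def qw Inr t)
  qed
qed

text \<open>Fixing two atoms fixes both sequences, so any condition on them holds locally. It is
  applied to a relation of the code and to its negation.\<close>

lemma openin_coords:
  fixes L :: "('f::countable, 'r::countable) fo_language"
  shows "openin (omega_topology L) {N \<in> omega_structures L. \<Phi> (coords (atoms L N) n) (coords (atoms L N) m)}" (is "openin _ ?A")
proof (subst openin_subopen, intro ballI)
  fix N0 assume N0: "N0 \<in> ?A"
  obtain c :: "'f + 'r" and zs where n: "\<And>P Q. P c zs = Q c zs \<Longrightarrow> coords P n = coords Q n"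
    using coords_depends_on_atom[of n] by metis
  obtain c' :: "'f + 'r" and zs' where m: "\<And>P Q. P c' zs' = Q c' zs' \<Longrightarrow> coords P m = coords Q m"
    using coords_depends_on_atom[of m] by metis
  let ?U = "{N \<in> omega_structures L. atoms L N c zs = atoms L N0 c zs} \<inter>
    {N \<in> omega_structures L. atoms L N c' zs' = atoms L N0 c' zs'}"
  have "openin (omega_topology L) ?U"
    by (intro openin_Int openin_atoms)
  moreover have "N0 \<in> ?U"
    using N0 by simp
  moreover have "?U \<subseteq> ?A"
  proof
    fix N assume N: "N \<in> ?U"
    then have "coords (atoms L N) n = coords (atoms L N0) n" "coords (atoms L N) m = coords (atoms L N0) m"
      by (intro n m; simp)+
    then show "N \<in> ?A"
      using N N0 by simp
  qed
  ultimately show "\<exists>T. openin (omega_topology L) T \<and> N0 \<in> T \<and> T \<subseteq> ?A"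
    by (intro exI[of _ ?U] conjI)
qed

lemma continuous_coord_code:
  "continuous_map (omega_topology L) (omega_topology coord_language) (coord_code L)"
  unfolding omega_topology_def[of coord_language]
proof (rule continuous_on_generated_topo)
  let ?\<Omega> = "omega_structures L" and ?\<Omega>' = "omega_structures coord_language"
  fix U assume U: "U \<in> {?\<Omega>'} \<union>
     {{N \<in> ?\<Omega>'. fun_int N f xs = y} | f xs y. f \<in> funs coord_language \<and> length xs = fun_arity coord_language f} \<union>
     {{N \<in> ?\<Omega>'. xs \<in> rel_int N R} | R xs. R \<in> rels coord_language \<and> length xs = rel_arity coord_language R} \<union>
     {{N \<in> ?\<Omega>'. xs \<notin> rel_int N R} | R xs. R \<in> rels coord_language \<and> length xs = rel_arity coord_language R}"
  have pair: "\<exists>n m. xs = [n, m]" if "length xs = rel_arity coord_language R" for xs :: "nat list" and R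
    using that by (auto simp: coord_language_def numeral_2_eq_2 length_Suc_conv)
  have space: "coord_code L -` {N \<in> ?\<Omega>'. \<Psi> N} \<inter> ?\<Omega> = {N \<in> ?\<Omega>. \<Psi> (coord_code L N)}" for \<Psi>
    using coord_code_in_omega_structures by auto
  have "funs coord_language = {}"
    by (simp add: coord_language_def)
  then consider "U = ?\<Omega>'"
    | R xs where "U = {N \<in> ?\<Omega>'. xs \<in> rel_int N R}" "length xs = rel_arity coord_language R"
    | R xs where "U = {N \<in> ?\<Omega>'. xs \<notin> rel_int N R}" "length xs = rel_arity coord_language R"
    using U by blast
  then show "openin (omega_topology L) (coord_code L -` U \<inter> topspace (omega_topology L))"
  proof cases
    case 1
    then have "coord_code L -` U \<inter> ?\<Omega> = ?\<Omega>"
      using coord_code_in_omega_structures by auto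
    then show ?thesis
      by (simp add: topspace_omega_topology openin_omega_subbasis(1))
  next
    case 2
    then obtain n m where xs: "xs = [n, m]"
      using pair by blast
    show ?thesis
      unfolding topspace_omega_topology 2(1) xs space unfolding coord_code_def coord_structure_simps
      by (rule openin_coords[where \<Phi> = "\<lambda>x y. x R = y R \<and> x R \<noteq> 0"])
  next
    case 3
    then obtain n m where xs: "xs = [n, m]"
      using pair by blast
    show ?thesis
      unfolding topspace_omega_topology 3(1) xs space unfolding coord_code_def coord_structure_simps
      by (rule openin_coords[where \<Phi> = "\<lambda>x y. \<not> (x R = y R \<and> x R \<noteq> 0)"])
  qed
next
  show "coord_code L ` topspace (omega_topology L) \<subseteq> \<Union> ({omega_structures coord_language} \<union>
     {{N \<in> omega_structures coord_language. fun_int N f xs = y} | f xs y.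
       f \<in> funs coord_language \<and> length xs = fun_arity coord_language f} \<union>
     {{N \<in> omega_structures coord_language. xs \<in> rel_int N R} | R xs.
       R \<in> rels coord_language \<and> length xs = rel_arity coord_language R} \<union>
     {{N \<in> omega_structures coord_language. xs \<notin> rel_int N R} | R xs.
       R \<in> rels coord_language \<and> length xs = rel_arity coord_language R})"
    using coord_code_in_omega_structures by auto
qed

lemma measurable_coord_code: "coord_code L \<in> omega_borel L \<rightarrow>\<^sub>M omega_borel coord_language"
  unfolding omega_borel_def[of coord_language]
proof (rule measurable_sigma_sets)
  show "sets (sigma (omega_structures coord_language) {U. openin (omega_topology coord_language) U}) =
      sigma_sets (omega_structures coord_language) {U. openin (omega_topology coord_language) U}"
    using sets_omega_borel unfolding omega_borel_def .
  show "{U. openin (omega_topology coord_language) U} \<subseteq> Pow (omega_structures coord_language)"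
    using openin_subset[of "omega_topology coord_language"] unfolding topspace_omega_topology by auto
  show "coord_code L \<in> space (omega_borel L) \<rightarrow> omega_structures coord_language"
    by (simp add: coord_code_in_omega_structures)
  fix U assume "U \<in> {U. openin (omega_topology coord_language) U}"
  then have "openin (omega_topology L) {N \<in> omega_structures L. coord_code L N \<in> U}"
    using openin_continuous_map_preimage[OF continuous_coord_code, of U L]
    by (simp add: topspace_omega_topology)
  moreover have "coord_code L -` U \<inter> space (omega_borel L) = {N \<in> omega_structures L. coord_code L N \<in> U}"
    by (auto simp: space_omega_borel)
  ultimately show "coord_code L -` U \<inter> space (omega_borel L) \<in> sets (omega_borel L)"
    by (simp add: sets_omega_borel sigma_sets.Basic)
qed

text \<open>The map is defined on the whole space of structures and reflects isomorphism everywhere,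
  so its restriction to \<open>K\<close> is the reduction; its values are models because all rich
  structures have the same theory.\<close>

lemma borel_complete_coord_structure:
  assumes "rich A d"
  shows "borel_complete coord_language (Th coord_language (coord_structure A d))"
  unfolding borel_complete_def
proof (intro allI impI)
  fix L :: "(nat, nat) fo_language" and K
  assume "countable_language L \<and> invariant_borel_class L K"
  then have "K \<in> sets (omega_borel L)"
    by (simp add: invariant_borel_class_def)
  then have K: "K \<subseteq> omega_structures L"
    using sets.sets_into_space space_omega_borel by metis
  let ?T = "Th coord_language (coord_structure A d)"
  have "coord_code L N \<in> Mod coord_language ?T" for N
    unfolding Mod_def using coord_code_in_omega_structures model_of_Th_coord_structure[OF assms rich_coords]
    by (simp add: coord_code_def)
  then have "coord_code L \<in> restrict_space (omega_borel L) K \<rightarrow>\<^sub>M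
      restrict_space (omega_borel coord_language) (Mod coord_language ?T)"
    by (intro measurable_restrict_space3 measurable_coord_code) simp
  moreover have "isomorphic L M N \<longleftrightarrow> isomorphic coord_language (coord_code L M) (coord_code L N)"
    if "M \<in> K" "N \<in> K" for M N
  proof -
    have "univ M = UNIV" "univ N = UNIV"
      using K that by (auto simp: omega_structures_def)
    note iso = isomorphic_iff_atoms[OF this]
    show ?thesis
      unfolding iso coord_code_def
    proof
      assume "\<exists>\<sigma>. bij \<sigma> \<and> (\<forall>s zs. atoms L M s zs \<longleftrightarrow> atoms L N s (map \<sigma> zs))"
      then show "isomorphic coord_language (coord_structure UNIV (coords (atoms L M)))
          (coord_structure UNIV (coords (atoms L N)))"
        using coords_isomorphic by metis
    next
      assume "isomorphic coord_language (coord_structure UNIV (coords (atoms L M)))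
          (coord_structure UNIV (coords (atoms L N)))"
      then show "\<exists>\<sigma>. bij \<sigma> \<and> (\<forall>s zs. atoms L M s zs \<longleftrightarrow> atoms L N s (map \<sigma> zs))"
        by (rule isomorphic_coords) metis
    qed
  qed
  ultimately show "borel_reducible L K coord_language (Mod coord_language ?T)"
    unfolding borel_reducible_def by (intro bexI[of _ "coord_code L"] ballI)
qed

theorem theorem3p2:
  fixes L :: "('f, 'r) fo_language"
    and T :: "('f, 'r) fm set"
    and M :: "('f, 'r, 'a) fo_structure"
  assumes "countable_language L"
    and "complete_theory L T"
    and "uncountable (complete_1_types L T)"
    and "model_of L T M"
  shows "has_borel_complete_reduct L M"
proof -
  obtain \<beta> :: "nat \<Rightarrow> 'a \<Rightarrow> bool" where \<beta>: "\<And>n. unary_definable L M (\<beta> n)"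
    "\<And>b F. finite F \<Longrightarrow> \<exists>a\<in>univ M. \<forall>n\<in>F. \<beta> n a = b n"
    using independent_definable_sets[OF assms(1,2,4,3)] by metis
  have rich: "rich (univ M) (count_coord \<beta>)"
    using \<beta>(2) by (rule rich_count_coord)
  have "structure_of L M"
    using assms(4) by (simp add: model_of_def)
  then have "reduct L M coord_language (coord_structure (univ M) (count_coord \<beta>))"
    using \<beta>(1) rich by (rule reduct_coord_structure)
  moreover note borel_complete_coord_structure[OF rich]
  ultimately show ?thesis
    unfolding has_borel_complete_reduct_def by (intro exI conjI)
qed

end
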